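(* Let $D$ be a finite set, $M=\mathrm{QoI}(D)$ and $\sigma:\mathit{Var}\to M_1$. Every map $\beta:\mathcal U(\mathit{Var})\to M$ that preserves arbitrary joins and is a sound read-out for $\sigma$ satisfies $\beta(\mathbb X)\sqsupseteq\alpha_\sigma(\mathbb X)$ for all $\mathbb X\in\mathcal U(\mathit{Var})$. Hence $\alpha_\sigma$ is the least sound join-preserving read-out for $\sigma$.
   Context: Quantale of information. $D$ is finite. $\mathrm{LoI}(D)$ is the set of equivalence relations on $D$ ordered by $P\sqsubseteq Q$ iff $Q\subseteq P$, so $P\sqcup Q=P\cap Q$, the least element $\mathrm{All}$ is the total relation and the greatest, $\mathrm{Id}$, is equality. For $\mathbb P\subseteq\mathrm{LoI}(D)$, $\mathrm{mix}(\mathbb P)$ is the set of equivalence relations each of whose cells is a cell of some member of $\mathbb P$, and $\mathrm{tc}(\mathbb P)={\downarrow}\mathrm{mix}(\mathbb P)$. $\mathrm{QoI}(D)$ is the set of $\mathbb P$ with $\mathrm{tc}(\mathbb P)=\mathbb P$, ordered by inclusion (written $\sqsubseteq$), with $\bigvee_i\mathbb P_i=\mathrm{tc}(\bigcup_i\mathbb P_i)$, $\mathbb P\otimes\mathbb Q=\mathrm{tc}\{P\sqcup Q\mid P\in\mathbb P,Q\in\mathbb Q\}$, unit $1=\{\mathrm{All}\}$; it is a commutative complete quantale. For a quantale $M$, $M_1=\{m\mid 1\sqsubseteq m\}$, $m^0=1$, $m^n$ is the $n$-fold tensor power, $m^*=\bigvee_{n\ge0}m^n$; empty tensors are $1$.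 Language. $\mathit{Var}$ is finite; stores are maps $\mathit{Var}\to\mathit{Val}$. $\mathit{Val}$ contains an encoding (injective image) of every quotient $D/P$, $P\in\mathrm{LoI}(D)$, and supports injective pairing; expressions include tuples $\langle v_1,\dots,v_k\rangle$ of variables, interpreted injectively. Commands: $\mathsf{skip}$, $x:=E$, $C_1;C_2$, $\mathsf{if}\;E\;C_1\;C_2$, $\mathsf{while}\;E\;C$, with the standard semantics $\llbracket C\rrbracket$, a partial function on stores (undefined on nontermination). Expressions evaluate totally, their value depends only on the variables in $\mathit{fv}(E)$, and guards are decided by a fixed two-valued test on the value of $E$. $\mathit{asgn}(C)$ is the set of variables assigned in $C$. $\pi_W$ restricts a store to $W$. Mediators. For a partial function $h$ on $D$ and $\mathbb P\in\mathrm{QoI}(D)$, $h:\mathbb P\Rightarrow\mathrm{Id}$ means: some $P\in\mathbb P$ satisfies $h(d)=h(d')$ whenever $d\,P\,d'$ and both are defined. A mediator family is $g=\langle g_v:D\rightharpoonup\mathit{Val}\rangle_{v\in\mathit{Var}}$ of partial functions with a common domain; $\hat g(d)$ is the store with $v$-component $g_v(d)$. $g$ is legal for $\sigma$ when $g_v:\sigma(v)\Rightarrow\mathrm{Id}$ for every $v$. Set object. $\mathcal U=\mathcal U(\mathit{Var})$ is the set of downsets of $(\mathcal P(\mathit{Var}),\subseteq)$ ordered by inclusion, with $\bigvee=\bigcup$, $\mathbb X\otimes\mathbb Y={\downarrow}\{X\cup Y\mid X\in\mathbb X,Y\in\mathbb Y\}$, $1={\downarrow}\emptyset$; generators $\hat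 v={\downarrow}\{v\}$. $\alpha_\sigma(\mathbb X)=\bigvee_{X\in\mathbb X}\bigotimes_{v\in X}\sigma(v)$. Algorithmic system. For a commutative complete quantale $M$, $t_E(\Gamma)=\bigotimes_{v\in\mathit{fv}(E)}\Gamma(v)$ and $\mathcal A^C_M(p,\Gamma):\mathit{Var}\to M_1$ ($p\in M_1$, $\Gamma:\mathit{Var}\to M_1$) is defined by recursion on $C$: $\Gamma$ for $\mathsf{skip}$; $\Gamma[x\mapsto p\otimes t_E(\Gamma)]$ for $x:=E$; $\mathcal A^{C_2}(p,\mathcal A^{C_1}(p,\Gamma))$ for $C_1;C_2$; for $\mathsf{if}\;E\;C_1\;C_2$, with $t=t_E(\Gamma)$, $\Gamma_i'=\mathcal A^{C_i}(p\otimes t,\Gamma)$, the environment $x\mapsto t\otimes(\Gamma_1'(x)\vee\Gamma_2'(x))$ for $x\in\mathit{asgn}(C_1)\cup\mathit{asgn}(C_2)$ and $x\mapsto\Gamma(x)$ otherwise; for $\mathsf{while}\;E\;C$, with $\Gamma^*$ the least fixed point of $\Theta\mapsto\Gamma\vee\mathcal A^C(p\otimes t_E(\Theta),\Theta)$ and $t=t_E(\Gamma^* )$, the environment $x\mapsto t^*\otimes\Gamma^*(x)$ for $x\in\mathit{asgn}(C)$ and $x\mapsto\Gamma^*(x)$ otherwise. $\Delta_C=\mathcal A^C_{\mathcal U}(1,\Delta_0)$ with $\Delta_0(v)=\hat v$; $\mathbb J_W=\bigotimes_{w\in W}\Delta_C(w)$. Sound read-out. A map $\beta:\mathcal U\to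 M$ is a sound read-out for $\sigma$ if for every command $C$, every $W\subseteq\mathit{Var}$ and every $g$ legal for $\sigma$, $\pi_W\circ\llbracket C\rrbracket\circ\hat g:\beta(\mathbb J_W)\Rightarrow\mathrm{Id}$. *)

theory Defs
  imports "HOL-Algebra.FiniteProduct"
begin

section \<open>Commutative complete quantales\<close>

record 'm quantale = "'m monoid" +
  qle :: "'m \<Rightarrow> 'm \<Rightarrow> bool"
  qSup :: "'m set \<Rightarrow> 'm"

locale comm_quantale = comm_monoid M for M (structure) +
  assumes qle_refl: "a \<in> carrier M \<Longrightarrow> qle M a a"
    and qle_antisym: "\<lbrakk>a \<in> carrier M; b \<in> carrier M; qle M a b; qle M b a\<rbrakk> \<Longrightarrow> a = b"
    and qle_trans: "\<lbrakk>a \<in> carrier M; b \<in> carrier M; c \<in> carrier M; qle M a b; qle M b c\<rbrakk>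
          \<Longrightarrow> qle M a c"
    and qSup_closed: "S \<subseteq> carrier M \<Longrightarrow> qSup M S \<in> carrier M"
    and qSup_upper: "\<lbrakk>S \<subseteq> carrier M; a \<in> S\<rbrakk> \<Longrightarrow> qle M a (qSup M S)"
    and qSup_least: "\<lbrakk>S \<subseteq> carrier M; b \<in> carrier M; \<And>a. a \<in> S \<Longrightarrow> qle M a b\<rbrakk>
          \<Longrightarrow> qle M (qSup M S) b"
    and tensor_qSup: "\<lbrakk>a \<in> carrier M; S \<subseteq> carrier M\<rbrakk>
          \<Longrightarrow> a \<otimes> qSup M S = qSup M ((\<lambda>b. a \<otimes> b) ` S)"

definition above_unit :: "('m, 'z) quantale_scheme \<Rightarrow> 'm set" where
  "above_unit M = {m \<in> carrier M. qle M \<one>\<^bsub>M\<^esub> m}"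

definition qstar :: "('m, 'z) quantale_scheme \<Rightarrow> 'm \<Rightarrow> 'm" where
  "qstar M m = qSup M (range (\<lambda>n::nat. m [^]\<^bsub>M\<^esub> n))"

section \<open>The quantale of information\<close>

text \<open>The order on \<^term>\<open>LoI D\<close> is reverse inclusion, so the join of two relations is their
  intersection, and \<open>Q\<close> lies below \<open>R\<close> iff \<open>R \<subseteq> Q\<close>.\<close>

definition LoI :: "'d set \<Rightarrow> ('d \<times> 'd) set set" where
  "LoI D = {P. equiv D P}"

definition mix :: "'d set \<Rightarrow> ('d \<times> 'd) set set \<Rightarrow> ('d \<times> 'd) set set" where
  "mix D PP = {Q \<in> LoI D. \<forall>c \<in> D // Q. \<exists>P\<in>PP. c \<in> D // P}"

definition tc :: "'d set \<Rightarrow> ('d \<times> 'd) set set \<Rightarrow> ('d \<times> 'd) set set" where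
  "tc D PP = {Q \<in> LoI D. \<exists>R \<in> mix D PP. R \<subseteq> Q}"

definition QoI :: "'d set \<Rightarrow> ('d \<times> 'd) set set quantale" where
  "QoI D =
    \<lparr>carrier = {PP. PP \<subseteq> LoI D \<and> tc D PP = PP},
     monoid.mult = (\<lambda>PP QQ. tc D {P \<inter> Q | P Q. P \<in> PP \<and> Q \<in> QQ}),
     one = {D \<times> D},
     qle = (\<subseteq>),
     qSup = (\<lambda>S. tc D (\<Union>S))\<rparr>"

section \<open>Downsets of sets of variables\<close>

definition down :: "'v set set \<Rightarrow> 'v set set" where
  "down XX = {Y. \<exists>X\<in>XX. Y \<subseteq> X}"

definition setobj :: "'v set set quantale" where
  "setobj =
    \<lparr>carrier = {XX. down XX = XX},
     monoid.mult = (\<lambda>XX YY. down {X \<union> Y | X Y. X \<in> XX \<and> Y \<in> YY}),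
     one = down {{}},
     qle = (\<subseteq>),
     qSup = (\<lambda>S. \<Union>S)\<rparr>"

definition gen :: "'v \<Rightarrow> 'v set set" where
  "gen v = down {{v}}"

definition alpha :: "'d set \<Rightarrow> ('v \<Rightarrow> ('d \<times> 'd) set set) \<Rightarrow> 'v set set \<Rightarrow> ('d \<times> 'd) set set" where
  "alpha D \<sigma> XX = qSup (QoI D) ((\<lambda>X. \<Otimes>\<^bsub>QoI D\<^esub> v\<in>X. \<sigma> v) ` XX)"

section \<open>The language\<close>

text \<open>Expressions form an arbitrary type \<open>'e\<close>, given through their free variables and their total
  evaluation; \<open>tuple [v\<^sub>1, \<dots>, v\<^sub>k]\<close> is the tuple expression, required only for \<open>k \<ge> 1\<close>.\<close>

locale expression_language =
  fixes fv :: "'e \<Rightarrow> 'v set"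
    and eval :: "'e \<Rightarrow> ('v \<Rightarrow> 'val) \<Rightarrow> 'val"
    and tuple :: "'v list \<Rightarrow> 'e"
  assumes eval_cong: "(\<And>v. v \<in> fv E \<Longrightarrow> s v = s' v) \<Longrightarrow> eval E s = eval E s'"
    and fv_tuple: "vs \<noteq> [] \<Longrightarrow> fv (tuple vs) = set vs"
    and tuple_inj: "\<lbrakk>vs \<noteq> []; eval (tuple vs) s = eval (tuple vs) s'\<rbrakk> \<Longrightarrow> map s vs = map s' vs"

datatype ('v, 'e) com =
    Skip
  | Assign 'v 'e
  | Seq "('v, 'e) com" "('v, 'e) com"
  | If 'e "('v, 'e) com" "('v, 'e) com"
  | While 'e "('v, 'e) com"

primrec asgn :: "('v, 'e) com \<Rightarrow> 'v set" where
  "asgn Skip = {}"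
| "asgn (Assign x E) = {x}"
| "asgn (Seq C1 C2) = asgn C1 \<union> asgn C2"
| "asgn (If E C1 C2) = asgn C1 \<union> asgn C2"
| "asgn (While E C) = asgn C"

inductive big_step ::
  "('e \<Rightarrow> ('v \<Rightarrow> 'val) \<Rightarrow> 'val) \<Rightarrow> ('val \<Rightarrow> bool) \<Rightarrow> ('v, 'e) com
    \<Rightarrow> ('v \<Rightarrow> 'val) \<Rightarrow> ('v \<Rightarrow> 'val) \<Rightarrow> bool"
  for eval :: "'e \<Rightarrow> ('v \<Rightarrow> 'val) \<Rightarrow> 'val" and test :: "'val \<Rightarrow> bool" where
  Skip: "big_step eval test Skip s s"
| Assign: "big_step eval test (Assign x E) s (s(x := eval E s))"
| Seq: "\<lbrakk>big_step eval test C1 s s'; big_step eval test C2 s' s''\<rbrakk>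
    \<Longrightarrow> big_step eval test (Seq C1 C2) s s''"
| IfTrue: "\<lbrakk>test (eval E s); big_step eval test C1 s s'\<rbrakk>
    \<Longrightarrow> big_step eval test (If E C1 C2) s s'"
| IfFalse: "\<lbrakk>\<not> test (eval E s); big_step eval test C2 s s'\<rbrakk>
    \<Longrightarrow> big_step eval test (If E C1 C2) s s'"
| WhileFalse: "\<not> test (eval E s) \<Longrightarrow> big_step eval test (While E C) s s"
| WhileTrue: "\<lbrakk>test (eval E s); big_step eval test C s s'; big_step eval test (While E C) s' s''\<rbrakk>
    \<Longrightarrow> big_step eval test (While E C) s s''"

inductive_cases big_step_cases:
  "big_step eval test Skip s t"
  "big_step eval test (Assign x E) s t"
  "big_step eval test (Seq C1 C2) s t"
  "big_step eval test (If E C1 C2) s t"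
  "big_step eval test (While E C) s t"

lemma big_step_deterministic:
  "\<lbrakk>big_step eval test C s t; big_step eval test C s u\<rbrakk> \<Longrightarrow> u = t"
proof (induction arbitrary: u rule: big_step.induct)
  case (Skip s)
  then show ?case by (auto elim: big_step_cases(1))
next
  case (Assign x E s)
  then show ?case by (auto elim: big_step_cases(2))
next
  case (Seq C1 s s' C2 s'')
  from Seq.prems Seq.IH show ?case by (metis big_step_cases(3))
next
  case (IfTrue E s C1 s' C2)
  from IfTrue.prems IfTrue.hyps(1) IfTrue.IH show ?case by (metis big_step_cases(4))
next
  case (IfFalse E s C2 s' C1)
  from IfFalse.prems IfFalse.hyps(1) IfFalse.IH show ?case by (metis big_step_cases(4))
next
  case (WhileFalse E s C)
  from WhileFalse.prems WhileFalse.hyps show ?case by (metis big_step_cases(5))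
next
  case (WhileTrue E s C s' s'')
  from WhileTrue.prems WhileTrue.hyps(1) WhileTrue.IH show ?case by (metis big_step_cases(5))
qed

definition sem ::
  "('e \<Rightarrow> ('v \<Rightarrow> 'val) \<Rightarrow> 'val) \<Rightarrow> ('val \<Rightarrow> bool) \<Rightarrow> ('v, 'e) com \<Rightarrow> ('v \<Rightarrow> 'val) \<rightharpoonup> ('v \<Rightarrow> 'val)" where
  "sem eval test C s =
    (if \<exists>t. big_step eval test C s t then Some (THE t. big_step eval test C s t) else None)"

section \<open>Mediators\<close>

text \<open>\<^term>\<open>determines h PP\<close> is the relation \<open>h : PP \<Rightarrow> Id\<close>.\<close>

definition determines :: "('d \<rightharpoonup> 'b) \<Rightarrow> ('d \<times> 'd) set set \<Rightarrow> bool" where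
  "determines h PP \<longleftrightarrow>
    (\<exists>P\<in>PP. \<forall>d d'. (d, d') \<in> P \<longrightarrow> d \<in> dom h \<longrightarrow> d' \<in> dom h \<longrightarrow> h d = h d')"

definition mediator :: "'d set \<Rightarrow> ('v \<Rightarrow> 'd \<rightharpoonup> 'val) \<Rightarrow> bool" where
  "mediator D g \<longleftrightarrow> (\<exists>A \<subseteq> D. \<forall>v. dom (g v) = A)"

definition store_of :: "('v \<Rightarrow> 'd \<rightharpoonup> 'val) \<Rightarrow> 'd \<rightharpoonup> ('v \<Rightarrow> 'val)" where
  "store_of g d = (if \<forall>v. d \<in> dom (g v) then Some (\<lambda>v. the (g v d)) else None)"

definition legal :: "('v \<Rightarrow> ('d \<times> 'd) set set) \<Rightarrow> ('v \<Rightarrow> 'd \<rightharpoonup> 'val) \<Rightarrow> bool" where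
  "legal \<sigma> g \<longleftrightarrow> (\<forall>v. determines (g v) (\<sigma> v))"

section \<open>The algorithmic system\<close>

definition texpr :: "('e \<Rightarrow> 'v set) \<Rightarrow> ('m, 'z) quantale_scheme \<Rightarrow> 'e \<Rightarrow> ('v \<Rightarrow> 'm) \<Rightarrow> 'm" where
  "texpr fv M E \<Gamma> = (\<Otimes>\<^bsub>M\<^esub> v\<in>fv E. \<Gamma> v)"

text \<open>The fixed point is taken among environments with values above the unit, ordered pointwise.\<close>

definition least_fixpoint ::
  "('m, 'z) quantale_scheme \<Rightarrow> (('v \<Rightarrow> 'm) \<Rightarrow> 'v \<Rightarrow> 'm) \<Rightarrow> 'v \<Rightarrow> 'm" where
  "least_fixpoint M F =
    (THE \<Theta>. \<Theta> \<in> UNIV \<rightarrow> above_unit M \<and> F \<Theta> = \<Theta> \<and>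
      (\<forall>\<Theta>'. \<Theta>' \<in> UNIV \<rightarrow> above_unit M \<and> F \<Theta>' = \<Theta>' \<longrightarrow> (\<forall>v. qle M (\<Theta> v) (\<Theta>' v))))"

primrec alg ::
  "('e \<Rightarrow> 'v set) \<Rightarrow> ('m, 'z) quantale_scheme \<Rightarrow> ('v, 'e) com \<Rightarrow> 'm \<Rightarrow> ('v \<Rightarrow> 'm) \<Rightarrow> 'v \<Rightarrow> 'm" where
  "alg fv M Skip = (\<lambda>p \<Gamma>. \<Gamma>)"
| "alg fv M (Assign x E) = (\<lambda>p \<Gamma>. \<Gamma>(x := p \<otimes>\<^bsub>M\<^esub> texpr fv M E \<Gamma>))"
| "alg fv M (Seq C1 C2) = (\<lambda>p \<Gamma>. alg fv M C2 p (alg fv M C1 p \<Gamma>))"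
| "alg fv M (If E C1 C2) = (\<lambda>p \<Gamma>.
    let t = texpr fv M E \<Gamma>;
        \<Gamma>1 = alg fv M C1 (p \<otimes>\<^bsub>M\<^esub> t) \<Gamma>;
        \<Gamma>2 = alg fv M C2 (p \<otimes>\<^bsub>M\<^esub> t) \<Gamma>
    in (\<lambda>x. if x \<in> asgn C1 \<union> asgn C2 then t \<otimes>\<^bsub>M\<^esub> qSup M {\<Gamma>1 x, \<Gamma>2 x} else \<Gamma> x))"
| "alg fv M (While E C) = (\<lambda>p \<Gamma>.
    let \<Gamma>s = least_fixpoint M
          (\<lambda>\<Theta> x. qSup M {\<Gamma> x, alg fv M C (p \<otimes>\<^bsub>M\<^esub> texpr fv M E \<Theta>) \<Theta> x});
        t = texpr fv M E \<Gamma>s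
    in (\<lambda>x. if x \<in> asgn C then qstar M t \<otimes>\<^bsub>M\<^esub> \<Gamma>s x else \<Gamma>s x))"

definition Delta :: "('e \<Rightarrow> 'v set) \<Rightarrow> ('v, 'e) com \<Rightarrow> 'v \<Rightarrow> 'v set set" where
  "Delta fv C = alg fv setobj C \<one>\<^bsub>setobj\<^esub> gen"

definition JJ :: "('e \<Rightarrow> 'v set) \<Rightarrow> ('v, 'e) com \<Rightarrow> 'v set \<Rightarrow> 'v set set" where
  "JJ fv C W = (\<Otimes>\<^bsub>setobj\<^esub> w\<in>W. Delta fv C w)"

section \<open>Read-outs\<close>

definition sound_readout ::
  "('e \<Rightarrow> 'v set) \<Rightarrow> ('e \<Rightarrow> ('v \<Rightarrow> 'val) \<Rightarrow> 'val) \<Rightarrow> ('val \<Rightarrow> bool) \<Rightarrow> 'd set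
    \<Rightarrow> ('v \<Rightarrow> ('d \<times> 'd) set set) \<Rightarrow> ('v set set \<Rightarrow> ('d \<times> 'd) set set) \<Rightarrow> bool" where
  "sound_readout fv eval test D \<sigma> \<beta> \<longleftrightarrow>
    (\<forall>(C :: ('v, 'e) com) W g. mediator D g \<and> legal \<sigma> g \<longrightarrow>
      determines (map_option (\<lambda>s. restrict s W) \<circ> (sem eval test C \<circ>\<^sub>m store_of g))
        (\<beta> (JJ fv C W)))"

definition join_preserving ::
  "('a, 'y) quantale_scheme \<Rightarrow> ('b, 'z) quantale_scheme \<Rightarrow> ('a \<Rightarrow> 'b) \<Rightarrow> bool" where
  "join_preserving L M \<beta> \<longleftrightarrow> (\<forall>S \<subseteq> carrier L. \<beta> (qSup L S) = qSup M (\<beta> ` S))"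

section \<open>Both structures are commutative complete quantales\<close>

lemma setobj_simps:
  "carrier setobj = {XX. down XX = XX}" "one setobj = down {{}}" "qle setobj = (\<subseteq>)"
  "qSup setobj S = \<Union>S"
  by (simp_all add: setobj_def)

lemma mem_setobj_mult:
  "Z \<in> XX \<otimes>\<^bsub>setobj\<^esub> YY \<longleftrightarrow> (\<exists>X\<in>XX. \<exists>Y\<in>YY. Z \<subseteq> X \<union> Y)"
proof -
  have "Z \<in> XX \<otimes>\<^bsub>setobj\<^esub> YY \<longleftrightarrow> (\<exists>W\<in>{X \<union> Y | X Y. X \<in> XX \<and> Y \<in> YY}. Z \<subseteq> W)"
    by (simp add: setobj_def down_def)
  also have "\<dots> \<longleftrightarrow> (\<exists>X\<in>XX. \<exists>Y\<in>YY. Z \<subseteq> X \<union> Y)" by blast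
  finally show ?thesis .
qed

lemma setobj_assoc:
  "(XX \<otimes>\<^bsub>setobj\<^esub> YY) \<otimes>\<^bsub>setobj\<^esub> ZZ = XX \<otimes>\<^bsub>setobj\<^esub> (YY \<otimes>\<^bsub>setobj\<^esub> ZZ)"
proof (rule Set.set_eqI)
  fix V
  show "V \<in> (XX \<otimes>\<^bsub>setobj\<^esub> YY) \<otimes>\<^bsub>setobj\<^esub> ZZ \<longleftrightarrow> V \<in> XX \<otimes>\<^bsub>setobj\<^esub> (YY \<otimes>\<^bsub>setobj\<^esub> ZZ)"
  proof
    assume "V \<in> (XX \<otimes>\<^bsub>setobj\<^esub> YY) \<otimes>\<^bsub>setobj\<^esub> ZZ"
    then obtain W Z where "W \<in> XX \<otimes>\<^bsub>setobj\<^esub> YY" and Z: "Z \<in> ZZ" "V \<subseteq> W \<union> Z"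
      unfolding mem_setobj_mult[of V] by (elim bexE)
    then obtain X Y where in3: "X \<in> XX" "Y \<in> YY" "Z \<in> ZZ" and "W \<subseteq> X \<union> Y" "V \<subseteq> W \<union> Z"
      unfolding mem_setobj_mult by blast
    from this(4,5) have "V \<subseteq> X \<union> (Y \<union> Z)" by blast
    moreover have "Y \<union> Z \<in> YY \<otimes>\<^bsub>setobj\<^esub> ZZ"
      unfolding mem_setobj_mult using in3 by blast
    ultimately show "V \<in> XX \<otimes>\<^bsub>setobj\<^esub> (YY \<otimes>\<^bsub>setobj\<^esub> ZZ)"
      unfolding mem_setobj_mult[of V] using in3(1) by (intro bexI)
  next
    assume "V \<in> XX \<otimes>\<^bsub>setobj\<^esub> (YY \<otimes>\<^bsub>setobj\<^esub> ZZ)"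
    then obtain X W where "W \<in> YY \<otimes>\<^bsub>setobj\<^esub> ZZ" and X: "X \<in> XX" "V \<subseteq> X \<union> W"
      unfolding mem_setobj_mult[of V] by (elim bexE)
    then obtain Y Z where in3: "X \<in> XX" "Y \<in> YY" "Z \<in> ZZ" and "W \<subseteq> Y \<union> Z" "V \<subseteq> X \<union> W"
      unfolding mem_setobj_mult by blast
    from this(4,5) have "V \<subseteq> (X \<union> Y) \<union> Z" by blast
    moreover have "X \<union> Y \<in> XX \<otimes>\<^bsub>setobj\<^esub> YY"
      unfolding mem_setobj_mult using in3 by blast
    ultimately show "V \<in> (XX \<otimes>\<^bsub>setobj\<^esub> YY) \<otimes>\<^bsub>setobj\<^esub> ZZ"
      unfolding mem_setobj_mult[of V] using in3(3) by (intro bexI)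
  qed
qed

lemma setobj_commute: "XX \<otimes>\<^bsub>setobj\<^esub> YY = YY \<otimes>\<^bsub>setobj\<^esub> XX"
proof (rule Set.set_eqI)
  fix Z show "Z \<in> XX \<otimes>\<^bsub>setobj\<^esub> YY \<longleftrightarrow> Z \<in> YY \<otimes>\<^bsub>setobj\<^esub> XX"
    unfolding mem_setobj_mult by (subst Un_commute) blast
qed

lemma down_idem: "down (down XX) = down XX"
  unfolding down_def by blast

lemma down_closed: "\<lbrakk>down XX = XX; X \<in> XX; Y \<subseteq> X\<rbrakk> \<Longrightarrow> Y \<in> XX"
  unfolding down_def by blast

lemma setobj_unit:
  assumes "down XX = XX" shows "\<one>\<^bsub>setobj\<^esub> \<otimes>\<^bsub>setobj\<^esub> XX = XX"
proof (rule Set.set_eqI)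
  fix Z
  have "Z \<in> \<one>\<^bsub>setobj\<^esub> \<otimes>\<^bsub>setobj\<^esub> XX \<longleftrightarrow> (\<exists>X\<in>XX. Z \<subseteq> X)"
    unfolding mem_setobj_mult by (simp add: setobj_def down_def)
  then show "Z \<in> \<one>\<^bsub>setobj\<^esub> \<otimes>\<^bsub>setobj\<^esub> XX \<longleftrightarrow> Z \<in> XX"
    using down_closed[OF assms] by blast
qed

lemma comm_quantale_setobj: "comm_quantale (setobj :: 'v set set quantale)"
proof (unfold_locales, goal_cases)
  case (1 x y) show ?case by (simp add: setobj_def down_idem)
next
  case (2 x y z) show ?case by (rule setobj_assoc)
next
  case 3 show ?case by (simp add: setobj_simps down_idem)
next
  case (4 x) then show ?case by (simp add: setobj_simps(1) setobj_unit)
next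
  case (5 x) then show ?case by (simp add: setobj_simps(1) setobj_unit setobj_commute[of x])
next
  case (6 x y) show ?case by (rule setobj_commute)
next
  case (7 a) show ?case by (simp add: setobj_simps)
next
  case (8 a b) then show ?case by (simp add: setobj_simps)
next
  case (9 a b c) then show ?case by (simp add: setobj_simps)
next
  case (10 S) then show ?case unfolding setobj_simps down_def by blast
next
  case (11 S a) then show ?case unfolding setobj_simps by blast
next
  case (12 S b)
  then have "\<And>a. a \<in> S \<Longrightarrow> a \<subseteq> b" by (simp add: setobj_simps)
  then show ?case by (simp add: setobj_simps Sup_least)
next
  case (13 a S)
  show ?case unfolding setobj_simps(4) 
  proof (rule Set.set_eqI)
    fix Z
    have "Z \<in> a \<otimes>\<^bsub>setobj\<^esub> \<Union>S \<longleftrightarrow> (\<exists>b\<in>S. \<exists>X\<in>a. \<exists>Y\<in>b. Z \<subseteq> X \<union> Y)"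
      unfolding mem_setobj_mult by blast
    then show "Z \<in> a \<otimes>\<^bsub>setobj\<^esub> \<Union>S \<longleftrightarrow> Z \<in> (\<Union>b\<in>S. a \<otimes>\<^bsub>setobj\<^esub> b)"
      by (simp add: mem_setobj_mult)
  qed
qed

lemma LoI_cell: "\<lbrakk>P \<in> LoI D; d \<in> D; d \<in> c; c \<in> D // P\<rbrakk> \<Longrightarrow> c = P `` {d}"
  unfolding LoI_def quotient_def by (auto dest: equiv_class_eq)

lemma LoI_self: "\<lbrakk>P \<in> LoI D; d \<in> D\<rbrakk> \<Longrightarrow> d \<in> P `` {d}"
  unfolding LoI_def by (auto elim: equivE simp: refl_on_def)

lemma LoI_eqI:
  assumes "P \<subseteq> D \<times> D" "\<And>d. d \<in> D \<Longrightarrow> (d, d) \<in> P" "\<And>d e. (d, e) \<in> P \<Longrightarrow> (e, d) \<in> P"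
    "\<And>d e f. \<lbrakk>(d, e) \<in> P; (e, f) \<in> P\<rbrakk> \<Longrightarrow> (d, f) \<in> P"
  shows "P \<in> LoI D"
proof -
  have "refl_on D P" using assms(2) by (rule refl_onI)
  moreover have "sym P" using assms(3) by (rule symI)
  moreover have "trans P" using assms(4) by (rule transI)
  ultimately show ?thesis using assms(1) by (simp add: LoI_def equivI)
qed

lemma LoI_D: assumes "P \<in> LoI D"
  shows "P \<subseteq> D \<times> D" "\<And>d. d \<in> D \<Longrightarrow> (d, d) \<in> P" "\<And>d e. (d, e) \<in> P \<Longrightarrow> (e, d) \<in> P"
    "\<And>d e f. \<lbrakk>(d, e) \<in> P; (e, f) \<in> P\<rbrakk> \<Longrightarrow> (d, f) \<in> P"
  using assms unfolding LoI_def equiv_def refl_on_def sym_def trans_def by blast+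

lemma LoI_Int: "\<lbrakk>P \<in> LoI D; Q \<in> LoI D\<rbrakk> \<Longrightarrow> P \<inter> Q \<in> LoI D"
proof (rule LoI_eqI)
  assume P: "P \<in> LoI D" and Q: "Q \<in> LoI D"
  show "P \<inter> Q \<subseteq> D \<times> D" using LoI_D(1)[OF P] by blast
  show "(d, d) \<in> P \<inter> Q" if "d \<in> D" for d using LoI_D(2)[OF P that] LoI_D(2)[OF Q that] by simp
  show "(e, d) \<in> P \<inter> Q" if "(d, e) \<in> P \<inter> Q" for d e
    using that LoI_D(3)[OF P] LoI_D(3)[OF Q] by simp
  show "(d, f) \<in> P \<inter> Q" if "(d, e) \<in> P \<inter> Q" "(e, f) \<in> P \<inter> Q" for d e f
    using that LoI_D(4)[OF P, of d e f] LoI_D(4)[OF Q, of d e f] by simp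
qed

lemma mix_iff:
  assumes "PP \<subseteq> LoI D"
  shows "R \<in> mix D PP \<longleftrightarrow> R \<in> LoI D \<and> (\<forall>d\<in>D. \<exists>P\<in>PP. R `` {d} = P `` {d})"
proof (cases "R \<in> LoI D")
  case True
  have "(\<forall>c \<in> D // R. \<exists>P\<in>PP. c \<in> D // P) \<longleftrightarrow> (\<forall>d\<in>D. \<exists>P\<in>PP. R `` {d} \<in> D // P)"
    unfolding quotient_def by blast
  also have "\<dots> \<longleftrightarrow> (\<forall>d\<in>D. \<exists>P\<in>PP. R `` {d} = P `` {d})"
  proof -
    have "R `` {d} \<in> D // P \<longleftrightarrow> R `` {d} = P `` {d}" if d: "d \<in> D" and "P \<in> PP" for d P
    proof
      have P: "P \<in> LoI D" using assms that by blast
      show "R `` {d} = P `` {d}" if "R `` {d} \<in> D // P"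
        by (rule LoI_cell[OF P d LoI_self[OF True d] that])
      show "R `` {d} \<in> D // P" if "R `` {d} = P `` {d}"
        unfolding that by (rule quotientI[OF d])
    qed
    then show ?thesis by simp
  qed
  finally show ?thesis using True by (simp add: mix_def)
qed (simp add: mix_def)

lemma tc_LoI: "tc D PP \<subseteq> LoI D" by (auto simp: tc_def)

lemma tc_mono:
  assumes "PP \<subseteq> QQ" shows "tc D PP \<subseteq> tc D QQ"
proof -
  have "mix D PP \<subseteq> mix D QQ" using assms by (force simp: mix_def)
  then show ?thesis by (auto simp: tc_def)
qed

lemma tc_extensive:
  assumes "PP \<subseteq> LoI D" shows "PP \<subseteq> tc D PP"
proof
  fix P assume P: "P \<in> PP"
  then have "P \<in> mix D PP" using assms by (auto simp: mix_def)
  then show "P \<in> tc D PP" using P assms by (auto simp: tc_def)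
qed

lemma tc_idem:
  assumes PP: "PP \<subseteq> LoI D"
  shows "tc D (tc D PP) = tc D PP"
proof
  show "tc D (tc D PP) \<subseteq> tc D PP"
  proof
    fix Q assume "Q \<in> tc D (tc D PP)"
    then obtain R where Q: "Q \<in> LoI D" "R \<subseteq> Q" and R: "R \<in> LoI D"
      and ex: "\<forall>d\<in>D. \<exists>P\<in>tc D PP. R `` {d} = P `` {d}"
      unfolding tc_def[of D "tc D PP"] by (auto simp: mix_iff[OF tc_LoI])
    have "\<exists>S\<in>mix D PP. \<forall>e\<in>R `` {d}. S `` {e} \<subseteq> R `` {d}" if d: "d \<in> D" for d
    proof -
      obtain P where P: "P \<in> tc D PP" and eq: "R `` {d} = P `` {d}" using ex d by blast
      then obtain S where S: "S \<in> mix D PP" "S \<subseteq> P" and PL: "P \<in> LoI D"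
        unfolding tc_def by blast
      have "k \<in> R `` {d}" if "e \<in> R `` {d}" "k \<in> S `` {e}" for e k
        using that LoI_D(4)[OF PL, of d e k] S(2) unfolding eq by auto
      then show ?thesis using S(1) by blast
    qed
    then have "\<forall>c\<in>D // R. \<exists>S\<in>mix D PP. \<forall>e\<in>c. S `` {e} \<subseteq> c"
      by (auto elim!: quotientE)
    then obtain f where f: "\<And>c. c \<in> D // R \<Longrightarrow> f c \<in> mix D PP"
      "\<And>c e. \<lbrakk>c \<in> D // R; e \<in> c\<rbrakk> \<Longrightarrow> f c `` {e} \<subseteq> c" by metis
    define S where "S = {(d, e). d \<in> D \<and> (d, e) \<in> f (R `` {d})}"
    have fL: "f (R `` {d}) \<in> LoI D" if "d \<in> D" for d
      using f(1)[OF quotientI[OF that]] by (simp add: mix_def)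
    have SR: "S \<subseteq> R"
    proof clarify
      fix d e assume "(d, e) \<in> S"
      then have "d \<in> D" "e \<in> f (R `` {d}) `` {d}" by (auto simp: S_def)
      then show "(d, e) \<in> R" using f(2)[OF quotientI[of d D R], of d] LoI_self[OF R] by blast
    qed
    have same: "R `` {d} = R `` {e}" if "(d, e) \<in> R" for d e
      using that R unfolding LoI_def by (auto dest: equiv_class_eq)
    have SL: "S \<in> LoI D"
    proof (rule LoI_eqI)
      show "S \<subseteq> D \<times> D" using SR LoI_D(1)[OF R] by blast
      show "(d, d) \<in> S" if "d \<in> D" for d
        using LoI_D(2)[OF fL[OF that] that] that by (simp add: S_def)
      show "(e, d) \<in> S" if "(d, e) \<in> S" for d e
      proof -
        have "d \<in> D" "(d, e) \<in> f (R `` {d})" using that by (auto simp: S_def)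
        moreover have "e \<in> D" using LoI_D(1)[OF R] SR that by blast
        moreover have "R `` {e} = R `` {d}" using same SR that by blast
        ultimately show ?thesis
          using LoI_D(3)[OF fL] by (simp add: S_def)
      qed
      show "(d, k) \<in> S" if "(d, e) \<in> S" "(e, k) \<in> S" for d e k
      proof -
        have "d \<in> D" "(d, e) \<in> f (R `` {d})" "(e, k) \<in> f (R `` {d})"
          using that same[of d e] subsetD[OF SR that(1)] by (simp_all add: S_def)
        then show ?thesis using LoI_D(4)[OF fL, of d d e k] by (simp add: S_def)
      qed
    qed
    have "S \<in> mix D PP"
      unfolding mix_iff[OF PP]
    proof (intro conjI ballI SL)
      fix d assume d: "d \<in> D"
      have "S `` {d} = f (R `` {d}) `` {d}" using d by (auto simp: S_def)
      moreover have "\<exists>P\<in>PP. f (R `` {d}) `` {d} = P `` {d}"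
        using f(1)[OF quotientI[OF d]] d unfolding mix_iff[OF PP] by blast
      ultimately show "\<exists>P\<in>PP. S `` {d} = P `` {d}" by simp
    qed
    then show "Q \<in> tc D PP" using Q SR unfolding tc_def by blast
  qed
qed (rule tc_extensive[OF tc_LoI])

lemma tc_least: "\<lbrakk>QQ \<subseteq> LoI D; PP \<subseteq> tc D QQ\<rbrakk> \<Longrightarrow> tc D PP \<subseteq> tc D QQ"
  using tc_mono[of PP "tc D QQ" D] tc_idem[of QQ D] by simp

definition joins :: "'d set set \<Rightarrow> 'd set set \<Rightarrow> 'd set set" where
  "joins PP QQ = {P \<inter> Q | P Q. P \<in> PP \<and> Q \<in> QQ}"

lemma joinsI: "\<lbrakk>P \<in> PP; Q \<in> QQ\<rbrakk> \<Longrightarrow> P \<inter> Q \<in> joins PP QQ"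
  by (auto simp: joins_def)

lemma joins_mono: "\<lbrakk>PP \<subseteq> PP'; QQ \<subseteq> QQ'\<rbrakk> \<Longrightarrow> joins PP QQ \<subseteq> joins PP' QQ'"
  unfolding joins_def by blast

lemma joinsE: "X \<in> joins PP QQ \<Longrightarrow> (\<And>P Q. \<lbrakk>X = P \<inter> Q; P \<in> PP; Q \<in> QQ\<rbrakk> \<Longrightarrow> thesis) \<Longrightarrow> thesis"
  unfolding joins_def by blast

lemma joins_commute_subset: "joins PP QQ \<subseteq> joins QQ PP"
proof
  fix X assume "X \<in> joins PP QQ"
  then obtain P Q where X: "X = P \<inter> Q" and PQ: "P \<in> PP" "Q \<in> QQ" by (rule joinsE)
  show "X \<in> joins QQ PP" unfolding X Int_commute[of P] by (rule joinsI[OF PQ(2,1)])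
qed

lemma joins_commute: "joins PP QQ = joins QQ PP"
  by (rule subset_antisym[OF joins_commute_subset joins_commute_subset])

lemma joins_assoc: "joins (joins PP QQ) RR = joins PP (joins QQ RR)"
proof
  show "joins (joins PP QQ) RR \<subseteq> joins PP (joins QQ RR)"
  proof
    fix X assume "X \<in> joins (joins PP QQ) RR"
    then obtain Y R where X: "X = Y \<inter> R" and Y: "Y \<in> joins PP QQ" and R: "R \<in> RR"
      by (rule joinsE)
    from Y obtain P Q where "Y = P \<inter> Q" and PQ: "P \<in> PP" "Q \<in> QQ" by (rule joinsE)
    then have "X = P \<inter> (Q \<inter> R)" using X by blast
    then show "X \<in> joins PP (joins QQ RR)" using joinsI[OF PQ(1) joinsI[OF PQ(2) R]] by simp
  qed
  show "joins PP (joins QQ RR) \<subseteq> joins (joins PP QQ) RR"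
  proof
    fix X assume "X \<in> joins PP (joins QQ RR)"
    then obtain P Y where X: "X = P \<inter> Y" and P: "P \<in> PP" and Y: "Y \<in> joins QQ RR"
      by (rule joinsE)
    from Y obtain Q R where "Y = Q \<inter> R" and QR: "Q \<in> QQ" "R \<in> RR" by (rule joinsE)
    then have "X = (P \<inter> Q) \<inter> R" using X by blast
    then show "X \<in> joins (joins PP QQ) RR" using joinsI[OF joinsI[OF P QR(1)] QR(2)] by simp
  qed
qed

lemma QoI_joins: "monoid.mult (QoI D) PP QQ = tc D (joins PP QQ)"
  by (simp add: QoI_def joins_def)

lemma QoI_simps:
  "carrier (QoI D) = {PP. PP \<subseteq> LoI D \<and> tc D PP = PP}"
  "one (QoI D) = {D \<times> D}" "qle (QoI D) = (\<subseteq>)" "qSup (QoI D) S = tc D (\<Union>S)"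
  by (simp_all add: QoI_def)

lemma joins_LoI: "\<lbrakk>PP \<subseteq> LoI D; QQ \<subseteq> LoI D\<rbrakk> \<Longrightarrow> joins PP QQ \<subseteq> LoI D"
  unfolding joins_def using LoI_Int by blast

lemma joins_tc:
  assumes PP: "PP \<subseteq> LoI D" and QQ: "QQ \<subseteq> LoI D"
  shows "joins (tc D PP) (tc D QQ) \<subseteq> tc D (joins PP QQ)"
proof
  fix X assume "X \<in> joins (tc D PP) (tc D QQ)"
  then obtain P Q where X: "X = P \<inter> Q" and P: "P \<in> tc D PP" and Q: "Q \<in> tc D QQ"
    unfolding joins_def by blast
  obtain R where R: "R \<in> mix D PP" "R \<subseteq> P" using P unfolding tc_def by blast
  obtain S where S: "S \<in> mix D QQ" "S \<subseteq> Q" using Q unfolding tc_def by blast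
  have "R \<inter> S \<in> mix D (joins PP QQ)"
    unfolding mix_iff[OF joins_LoI[OF assms]]
  proof (intro conjI ballI)
    show "R \<inter> S \<in> LoI D" using R S by (simp add: mix_def LoI_Int)
    fix d assume d: "d \<in> D"
    obtain P' where P': "P' \<in> PP" "R `` {d} = P' `` {d}"
      using R(1) d unfolding mix_iff[OF PP] by blast
    obtain Q' where Q': "Q' \<in> QQ" "S `` {d} = Q' `` {d}"
      using S(1) d unfolding mix_iff[OF QQ] by blast
    have "(R \<inter> S) `` {d} = R `` {d} \<inter> S `` {d}" by blast
    also have "\<dots> = (P' \<inter> Q') `` {d}" unfolding P' Q' by blast
    finally show "\<exists>P\<in>joins PP QQ. (R \<inter> S) `` {d} = P `` {d}"
      using joinsI[OF P'(1) Q'(1)] by blast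
  qed
  moreover have "P \<inter> Q \<in> LoI D" using P Q tc_LoI LoI_Int by blast
  moreover have "R \<inter> S \<subseteq> P \<inter> Q" using R S by blast
  ultimately show "X \<in> tc D (joins PP QQ)" unfolding X tc_def by blast
qed

lemma tc_joins_tc:
  assumes "PP \<subseteq> LoI D" "QQ \<subseteq> LoI D"
  shows "tc D (joins (tc D PP) (tc D QQ)) = tc D (joins PP QQ)"
proof
  show "tc D (joins (tc D PP) (tc D QQ)) \<subseteq> tc D (joins PP QQ)"
    by (rule tc_least[OF joins_LoI[OF assms] joins_tc[OF assms]])
  show "tc D (joins PP QQ) \<subseteq> tc D (joins (tc D PP) (tc D QQ))"
    by (intro tc_mono joins_mono tc_extensive assms)
qed

lemma comm_quantale_QoI: "comm_quantale (QoI D)"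
proof -
  have All: "D \<times> D \<in> LoI D" by (rule LoI_eqI) auto
  have oneL: "{D \<times> D} \<subseteq> LoI D" using All by simp
  have tc_one: "tc D {D \<times> D} = {D \<times> D}"
  proof
    show "tc D {D \<times> D} \<subseteq> {D \<times> D}"
    proof
      fix Q assume "Q \<in> tc D {D \<times> D}"
      then obtain R where Q: "Q \<in> LoI D" and RQ: "R \<subseteq> Q" and R: "R \<in> mix D {D \<times> D}"
        unfolding tc_def by blast
      have "(d, e) \<in> Q" if "d \<in> D" "e \<in> D" for d e
      proof -
        have "R `` {d} = (D \<times> D) `` {d}" using R that unfolding mix_iff[OF oneL] by simp
        then have "e \<in> R `` {d}" using that by simp
        then show ?thesis using RQ by blast
      qed
      then show "Q \<in> {D \<times> D}" using LoI_D(1)[OF Q] by auto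
    qed
  qed (rule tc_extensive[OF oneL])
  have assoc: "tc D (joins (tc D (joins x y)) z) = tc D (joins x (tc D (joins y z)))"
    if x: "x \<subseteq> LoI D" "tc D x = x" and y: "y \<subseteq> LoI D" and z: "z \<subseteq> LoI D" "tc D z = z" for x y z
    using tc_joins_tc[OF joins_LoI[OF x(1) y] z(1)] tc_joins_tc[OF x(1) joins_LoI[OF y z(1)]]
    unfolding x(2) z(2) joins_assoc by (rule trans[OF _ sym])
  have unit: "joins {D \<times> D} x = x" if "x \<subseteq> LoI D" for x
  proof -
    have "D \<times> D \<inter> P = P" if "P \<in> x" for P using LoI_D(1) \<open>x \<subseteq> LoI D\<close> that by blast
    then have "(\<lambda>P. D \<times> D \<inter> P) ` x = x" by simp
    moreover have "joins {D \<times> D} x = (\<lambda>P. D \<times> D \<inter> P) ` x" unfolding joins_def by blast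
    ultimately show ?thesis by simp
  qed
  show ?thesis
  proof (unfold_locales, goal_cases)
    case (1 x y) then show ?case
      by (simp only: QoI_simps QoI_joins mem_Collect_eq) (simp add: tc_LoI tc_idem joins_LoI)
  next
    case (2 x y z) then show ?case by (simp add: QoI_simps QoI_joins assoc)
  next
    case 3 show ?case by (simp add: QoI_simps tc_one All)
  next
    case (4 x) then show ?case by (simp add: QoI_simps QoI_joins unit)
  next
    case (5 x) then show ?case by (simp add: QoI_simps QoI_joins unit joins_commute[of x])
  next
    case (6 x y) show ?case by (simp add: QoI_joins joins_commute[of x])
  next
    case (7 a) show ?case by (simp add: QoI_simps)
  next
    case (8 a b) then show ?case by (simp add: QoI_simps)
  next
    case (9 a b c) then show ?case by (simp add: QoI_simps)
  next
    case (10 S)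
    then have "\<Union>S \<subseteq> LoI D" by (auto simp: QoI_simps)
    then show ?case by (simp add: QoI_simps tc_LoI tc_idem)
  next
    case (11 S a)
    then have "\<Union>S \<subseteq> LoI D" by (auto simp: QoI_simps)
    from tc_extensive[OF this] show ?case using 11(2) by (simp add: QoI_simps Sup_le_iff)
  next
    case (12 S b)
    then have "a \<subseteq> b" if "a \<in> S" for a using that by (simp add: QoI_simps)
    moreover have "tc D b = b" using 12 by (simp add: QoI_simps)
    ultimately have "\<Union>S \<subseteq> b" "tc D b = b" by (simp_all add: Sup_le_iff)
    then show ?case using tc_mono[of "\<Union>S" b D] by (simp add: QoI_simps)
  next
    case (13 a S)
    then have L: "\<Union>S \<subseteq> LoI D" and a: "a \<subseteq> LoI D" "tc D a = a" by (auto simp: QoI_simps)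
    let ?T = "\<Union>b\<in>S. tc D (joins a b)"
    have "tc D (joins a (tc D (\<Union>S))) = tc D (joins a (\<Union>S))"
      using tc_joins_tc[OF a(1) L] unfolding a(2) .
    also have "\<dots> = tc D ?T"
    proof
      have "joins a b \<subseteq> tc D (joins a b)" if "b \<in> S" for b
        using L that by (intro tc_extensive joins_LoI a) blast
      moreover have "joins a (\<Union>S) = (\<Union>b\<in>S. joins a b)" unfolding joins_def by blast
      ultimately show "tc D (joins a (\<Union>S)) \<subseteq> tc D ?T" by (intro tc_mono) auto
      have "tc D (joins a b) \<subseteq> tc D (joins a (\<Union>S))" if "b \<in> S" for b
        using that by (intro tc_mono joins_mono) auto
      then show "tc D ?T \<subseteq> tc D (joins a (\<Union>S))"
        by (intro tc_least joins_LoI L a) blast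
    qed
    finally show ?case by (simp add: QoI_simps QoI_joins)
  qed
qed

end

theory Submission
  imports Defs
begin

text \<open>For the lower bound, feed \<open>skip\<close> with a mediator that encodes, for each \<open>v \<in> X\<close>, the
  \<open>P\<^sub>v\<close>-class of the secret in \<open>v\<close>. The observed \<open>X\<close>-part of the store has kernel
  \<open>\<Inter>\<^sub>v P\<^sub>v\<close>, while \<open>\<J>\<^sub>X = \<down>{X}\<close>, so a sound read-out contains that kernel in
  \<open>\<beta>(\<down>{X})\<close>; joins do the rest.

  For soundness of \<open>\<alpha>\<^sub>\<sigma>\<close>, fix witnesses \<open>P\<^sub>v \<in> \<sigma>(v)\<close> of legality. The set object records which
  variables an observation may depend on, and the choice among them may itself vary with the secret,
  as in a decision tree. This partitions \<open>D\<close> into blocks, each a cell of some \<open>\<Inter>\<^sub>v\<^sub>\<in>\<^sub>X P\<^sub>v\<close>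
  with \<open>X\<close> in the inferred downset, and such partitions are what \<open>mix\<close> admits. Induction on commands
  shows that every inferred downset is correct in this sense, on terminating runs.\<close>

section \<open>Tensors of downsets\<close>

abbreviation U1 :: "'v set set set" where
  "U1 \<equiv> above_unit setobj"

text \<open>The unit of \<open>setobj\<close> is \<open>{{}}\<close>, so for a downset to lie above
  it means to contain the empty set.\<close>

lemma mem_U1: "XX \<in> U1 \<longleftrightarrow> XX \<in> carrier setobj \<and> {} \<in> XX"
  unfolding above_unit_def setobj_simps down_def by blast

lemma U1_carrier: "XX \<in> U1 \<Longrightarrow> XX \<in> carrier setobj"
  by (simp add: mem_U1)

lemma carrier_downD: "\<lbrakk>XX \<in> carrier setobj; X \<in> XX; Y \<subseteq> X\<rbrakk> \<Longrightarrow> Y \<in> XX"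
  by (auto simp: setobj_simps intro: down_closed)

lemma setobj_multI: "\<lbrakk>X \<in> XX; Y \<in> YY\<rbrakk> \<Longrightarrow> X \<union> Y \<in> XX \<otimes>\<^bsub>setobj\<^esub> YY"
  unfolding mem_setobj_mult by blast

lemma setobj_mult_closed:
  "\<lbrakk>XX \<in> carrier setobj; YY \<in> carrier setobj\<rbrakk> \<Longrightarrow> XX \<otimes>\<^bsub>setobj\<^esub> YY \<in> carrier setobj"
proof -
  interpret comm_quantale "setobj :: 'a set set quantale" by (rule comm_quantale_setobj)
  show "\<lbrakk>XX \<in> carrier setobj; YY \<in> carrier setobj\<rbrakk> \<Longrightarrow> XX \<otimes>\<^bsub>setobj\<^esub> YY \<in> carrier setobj"
    by (rule m_closed)
qed

lemma setobj_mult_mono: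
  "\<lbrakk>XX \<subseteq> XX'; YY \<subseteq> YY'\<rbrakk> \<Longrightarrow> XX \<otimes>\<^bsub>setobj\<^esub> YY \<subseteq> XX' \<otimes>\<^bsub>setobj\<^esub> YY'"
  by (rule subsetI) (auto simp: mem_setobj_mult)

text \<open>A factor in \<open>U1\<close> offers \<open>{}\<close> as a choice, so tensoring with it
  keeps every set of the other factor.\<close>

lemma setobj_mult_upper:
  assumes "XX \<in> U1" "YY \<in> U1"
  shows "XX \<subseteq> XX \<otimes>\<^bsub>setobj\<^esub> YY" "YY \<subseteq> XX \<otimes>\<^bsub>setobj\<^esub> YY"
  using setobj_mult_mono[of XX XX "{{}}" YY] setobj_mult_mono[of "{{}}" XX YY YY] assms
  by (force simp: mem_U1 mem_setobj_mult)+

lemma U1_mult: "\<lbrakk>XX \<in> U1; YY \<in> U1\<rbrakk> \<Longrightarrow> XX \<otimes>\<^bsub>setobj\<^esub> YY \<in> U1"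
  using setobj_mult_upper(1)[of XX YY] by (auto simp: mem_U1 setobj_mult_closed)

lemma U1_one: "\<one>\<^bsub>setobj\<^esub> \<in> U1"
  by (simp add: mem_U1 setobj_simps down_idem) (simp add: down_def)

lemma U1_Un: "\<lbrakk>XX \<in> U1; YY \<in> U1\<rbrakk> \<Longrightarrow> XX \<union> YY \<in> U1"
  unfolding mem_U1 setobj_simps down_def by blast

lemma U1_gen: "gen v \<in> U1"
  by (simp add: mem_U1 setobj_simps gen_def down_idem) (simp add: down_def)

text \<open>An element of a tensor is dominated by one set chosen from each factor. This
  choice-function form replaces the algebraic product in the arguments on monotonicity and
  dependence.\<close>

lemma mem_setobj_finprod:
  fixes \<Gamma> :: "'a \<Rightarrow> 'v set set"
  assumes "finite A" "\<And>v. v \<in> A \<Longrightarrow> \<Gamma> v \<in> carrier setobj"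
  shows "Z \<in> finprod setobj \<Gamma> A \<longleftrightarrow> (\<exists>f. (\<forall>v\<in>A. f v \<in> \<Gamma> v) \<and> Z \<subseteq> (\<Union>v\<in>A. f v))"
  using assms
proof (induction A arbitrary: Z rule: finite_induct)
  case empty
  interpret comm_quantale "setobj :: 'v set set quantale" by (rule comm_quantale_setobj)
  show ?case by (simp add: setobj_simps down_def)
next
  case (insert a A)
  interpret comm_quantale "setobj :: 'v set set quantale" by (rule comm_quantale_setobj)
  have "finprod setobj \<Gamma> (insert a A) = \<Gamma> a \<otimes>\<^bsub>setobj\<^esub> finprod setobj \<Gamma> A"
    using insert by (intro finprod_insert) auto
  then have "Z \<in> finprod setobj \<Gamma> (insert a A) \<longleftrightarrow>
      (\<exists>X\<in>\<Gamma> a. \<exists>Y. (\<exists>f. (\<forall>v\<in>A. f v \<in> \<Gamma> v) \<and> Y \<subseteq> (\<Union>v\<in>A. f v)) \<and> Z \<subseteq> X \<union> Y)"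
    using insert by (simp add: mem_setobj_mult Bex_def)
  also have "\<dots> \<longleftrightarrow> (\<exists>f. (\<forall>v\<in>insert a A. f v \<in> \<Gamma> v) \<and> Z \<subseteq> (\<Union>v\<in>insert a A. f v))"
  proof
    assume "\<exists>X\<in>\<Gamma> a. \<exists>Y. (\<exists>f. (\<forall>v\<in>A. f v \<in> \<Gamma> v) \<and> Y \<subseteq> (\<Union>v\<in>A. f v)) \<and> Z \<subseteq> X \<union> Y"
    then obtain X Y f where X: "X \<in> \<Gamma> a" and f: "\<forall>v\<in>A. f v \<in> \<Gamma> v"
      and Z: "Y \<subseteq> (\<Union>v\<in>A. f v)" "Z \<subseteq> X \<union> Y" by blast
    have "(\<Union>v\<in>insert a A. (f(a := X)) v) = X \<union> (\<Union>v\<in>A. f v)"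
      using insert.hyps by auto
    with Z have "Z \<subseteq> (\<Union>v\<in>insert a A. (f(a := X)) v)" by blast
    moreover have "\<forall>v\<in>insert a A. (f(a := X)) v \<in> \<Gamma> v" using X f by simp
    ultimately show "\<exists>f. (\<forall>v\<in>insert a A. f v \<in> \<Gamma> v) \<and> Z \<subseteq> (\<Union>v\<in>insert a A. f v)"
      by blast
  next
    assume "\<exists>f. (\<forall>v\<in>insert a A. f v \<in> \<Gamma> v) \<and> Z \<subseteq> (\<Union>v\<in>insert a A. f v)"
    then obtain f where f: "\<forall>v\<in>insert a A. f v \<in> \<Gamma> v" "Z \<subseteq> f a \<union> (\<Union>v\<in>A. f v)" by auto
    then have "(\<exists>g. (\<forall>v\<in>A. g v \<in> \<Gamma> v) \<and> (\<Union>v\<in>A. f v) \<subseteq> (\<Union>v\<in>A. g v))"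
      by (intro exI[of _ f]) simp
    with f show "\<exists>X\<in>\<Gamma> a. \<exists>Y. (\<exists>f. (\<forall>v\<in>A. f v \<in> \<Gamma> v) \<and> Y \<subseteq> (\<Union>v\<in>A. f v)) \<and> Z \<subseteq> X \<union> Y"
      by (intro bexI[of _ "f a"] exI[of _ "\<Union>v\<in>A. f v"] conjI) simp_all
  qed
  finally show ?case .
qed

lemma setobj_finprod_closed:
  fixes \<Gamma> :: "'a \<Rightarrow> 'v set set"
  shows "(\<And>v. v \<in> A \<Longrightarrow> \<Gamma> v \<in> carrier setobj) \<Longrightarrow> finprod setobj \<Gamma> A \<in> carrier setobj"
proof -
  interpret comm_quantale "setobj :: 'v set set quantale" by (rule comm_quantale_setobj)
  show "(\<And>v. v \<in> A \<Longrightarrow> \<Gamma> v \<in> carrier setobj) \<Longrightarrow> finprod setobj \<Gamma> A \<in> carrier setobj"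
    by (intro finprod_closed) blast
qed

text \<open>The largest choice takes \<open>{v}\<close> from every generator. Since
  \<open>Delta\<close> of \<open>Skip\<close> is \<open>gen\<close>, this computes what is inferred
  for observing \<open>X\<close> after \<open>Skip\<close>.\<close>

lemma setobj_finprod_gen:
  assumes "finite X" shows "finprod setobj gen X = down {X}"
proof (rule Set.set_eqI)
  fix Z
  have "Z \<in> finprod setobj gen X \<longleftrightarrow> (\<exists>f. (\<forall>v\<in>X. f v \<in> gen v) \<and> Z \<subseteq> (\<Union>v\<in>X. f v))"
    by (rule mem_setobj_finprod[OF assms U1_carrier[OF U1_gen]])
  also have "\<dots> \<longleftrightarrow> Z \<subseteq> X"
  proof
    show "Z \<subseteq> X" if "\<exists>f. (\<forall>v\<in>X. f v \<in> gen v) \<and> Z \<subseteq> (\<Union>v\<in>X. f v)"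
      using that unfolding gen_def down_def by blast
    show "\<exists>f. (\<forall>v\<in>X. f v \<in> gen v) \<and> Z \<subseteq> (\<Union>v\<in>X. f v)" if "Z \<subseteq> X"
      using that by (intro exI[of _ "\<lambda>v. {v}"]) (auto simp: gen_def down_def)
  qed
  finally show "Z \<in> finprod setobj gen X \<longleftrightarrow> Z \<in> down {X}" by (simp add: down_def)
qed

lemma U1_finprod:
  fixes \<Gamma> :: "'a \<Rightarrow> 'v set set"
  assumes "finite A" "\<And>v. \<Gamma> v \<in> U1"
  shows "finprod setobj \<Gamma> A \<in> U1"
proof -
  have \<Gamma>: "\<Gamma> v \<in> carrier setobj" "{} \<in> \<Gamma> v" for v using assms(2)[of v] by (auto simp: mem_U1)
  have "{} \<in> finprod setobj \<Gamma> A"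
    using \<Gamma> by (subst mem_setobj_finprod[where \<Gamma> = \<Gamma>, OF assms(1)]) (auto intro: exI[of _ "\<lambda>_. {}"])
  then show ?thesis using \<Gamma>(1) by (simp add: mem_U1 setobj_finprod_closed)
qed

lemma setobj_finprod_mono:
  fixes \<Gamma> \<Gamma>' :: "'a \<Rightarrow> 'v set set"
  assumes "finite A" "\<And>v. \<Gamma> v \<in> U1" "\<And>v. \<Gamma>' v \<in> U1" "\<And>v. \<Gamma> v \<subseteq> \<Gamma>' v"
  shows "finprod setobj \<Gamma> A \<subseteq> finprod setobj \<Gamma>' A"
proof
  fix Z assume Z: "Z \<in> finprod setobj \<Gamma> A"
  have \<Gamma>: "\<Gamma> v \<in> carrier setobj" "\<Gamma>' v \<in> carrier setobj" for v
    using assms(2)[of v] assms(3)[of v] by (auto simp: mem_U1)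
  from Z obtain f where f: "\<forall>v\<in>A. f v \<in> \<Gamma> v" "Z \<subseteq> (\<Union>v\<in>A. f v)"
    unfolding mem_setobj_finprod[where \<Gamma> = \<Gamma>, OF assms(1) \<Gamma>(1)] by blast
  then have "\<forall>v\<in>A. f v \<in> \<Gamma>' v" using assms(4) by blast
  then show "Z \<in> finprod setobj \<Gamma>' A"
    unfolding mem_setobj_finprod[where \<Gamma> = \<Gamma>', OF assms(1) \<Gamma>(2)] using f(2) by blast
qed

section \<open>Powers and star of downsets\<close>

lemma setobj_pow_closed: "XX \<in> carrier setobj \<Longrightarrow> XX [^]\<^bsub>setobj\<^esub> (n::nat) \<in> carrier setobj"
proof -
  interpret comm_quantale "setobj :: 'a set set quantale" by (rule comm_quantale_setobj)
  show "XX \<in> carrier setobj \<Longrightarrow> XX [^]\<^bsub>setobj\<^esub> n \<in> carrier setobj"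
    by (rule nat_pow_closed)
qed

lemma setobj_qstar: "qstar setobj XX = (\<Union>n::nat. XX [^]\<^bsub>setobj\<^esub> n)"
  by (simp add: qstar_def setobj_simps)

lemma U1_qstar:
  assumes "XX \<in> U1" shows "qstar setobj XX \<in> U1"
proof -
  have "XX [^]\<^bsub>setobj\<^esub> (n::nat) \<in> carrier setobj" for n
    using assms by (simp add: mem_U1 setobj_pow_closed)
  moreover have "{} \<in> XX [^]\<^bsub>setobj\<^esub> (0::nat)"
    by (simp add: U1_one[unfolded mem_U1])
  ultimately show ?thesis
    unfolding setobj_qstar mem_U1 setobj_simps down_def by blast
qed

lemma setobj_pow_mono: "XX \<subseteq> YY \<Longrightarrow> XX [^]\<^bsub>setobj\<^esub> (n::nat) \<subseteq> YY [^]\<^bsub>setobj\<^esub> n"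
  by (induction n) (simp_all add: setobj_mult_mono)

lemma setobj_qstar_mono: "XX \<subseteq> YY \<Longrightarrow> qstar setobj XX \<subseteq> qstar setobj YY"
  using setobj_pow_mono unfolding setobj_qstar by blast

text \<open>Each further set of \<open>S\<close> costs one tensor factor, so a finite union lies in
  some power. Loops use it with \<open>S\<close> the sets attached to the guards evaluated along a
  run.\<close>

lemma Union_in_qstar:
  assumes "finite S" "S \<subseteq> XX"
  shows "\<Union>S \<in> qstar setobj XX"
proof -
  have "\<exists>n::nat. \<Union>S \<in> XX [^]\<^bsub>setobj\<^esub> n" using assms
  proof (induction rule: finite_induct)
    case empty
    have "\<Union>{} \<in> XX [^]\<^bsub>setobj\<^esub> (0::nat)" by (simp add: U1_one[unfolded mem_U1])
    then show ?case by blast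
  next
    case (insert X S)
    then obtain n :: nat where "\<Union>S \<in> XX [^]\<^bsub>setobj\<^esub> n" by blast
    then have "\<Union>S \<union> X \<in> XX [^]\<^bsub>setobj\<^esub> Suc n" using insert.prems by (simp add: setobj_multI)
    then have "\<Union>(insert X S) \<in> XX [^]\<^bsub>setobj\<^esub> Suc n" by (simp add: Un_commute)
    then show ?case by blast
  qed
  then show ?thesis by (simp add: setobj_qstar)
qed

section \<open>The least fixed point over downsets\<close>

text \<open>The least downset containing \<open>{}\<close> and \<open>\<Theta> v\<close>: a
  retraction of arbitrary families onto environments with values in \<open>U1\<close>.\<close>

definition unit_closure :: "('v \<Rightarrow> 'v set set) \<Rightarrow> 'v \<Rightarrow> 'v set set" where
  "unit_closure \<Theta> = (\<lambda>v. insert {} (down (\<Theta> v)))"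

lemma unit_closure_U1: "unit_closure \<Theta> v \<in> U1"
  unfolding unit_closure_def mem_U1 setobj_simps down_def by blast

lemma unit_closure_id: "(\<And>v. \<Theta> v \<in> U1) \<Longrightarrow> unit_closure \<Theta> = \<Theta>"
  unfolding unit_closure_def mem_U1 setobj_simps by (auto simp: insert_absorb)

lemma unit_closure_mono: "\<Theta> \<le> \<Theta>' \<Longrightarrow> unit_closure \<Theta> v \<subseteq> unit_closure \<Theta>' v"
  unfolding unit_closure_def le_fun_def down_def by blast

text \<open>Environments above the unit form a subset of a function type rather than a type, so
  preservation of that subset is required together with monotonicity on it.\<close>

definition U1_monotone :: "(('v \<Rightarrow> 'v set set) \<Rightarrow> 'v \<Rightarrow> 'v set set) \<Rightarrow> bool" where
  "U1_monotone F \<longleftrightarrow>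
    (\<forall>\<Theta> v. (\<forall>u. \<Theta> u \<in> U1) \<longrightarrow> F \<Theta> v \<in> U1) \<and>
    (\<forall>\<Theta> \<Theta>' v. (\<forall>u. \<Theta> u \<in> U1) \<longrightarrow> (\<forall>u. \<Theta>' u \<in> U1) \<longrightarrow> (\<forall>u. \<Theta> u \<subseteq> \<Theta>' u) \<longrightarrow> F \<Theta> v \<subseteq> F \<Theta>' v)"

text \<open>Outside \<^term>\<open>U1\<close> the operator is not controlled, so it is precomposed with a closure to make it
  monotone on the whole function type.\<close>

lemma least_fixpoint_setobj:
  assumes F: "U1_monotone F"
  shows "least_fixpoint setobj F = lfp (F \<circ> unit_closure)" (is "_ = ?L")
    and "\<And>v. least_fixpoint setobj F v \<in> U1"
    and "F (least_fixpoint setobj F) = least_fixpoint setobj F"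
proof -
  have F1: "F \<Theta> v \<in> U1" if "\<And>u. \<Theta> u \<in> U1" for \<Theta> v
    using F that unfolding U1_monotone_def by blast
  have m: "mono (F \<circ> unit_closure)"
  proof (rule monoI)
    fix \<Theta> \<Theta>' :: "'a \<Rightarrow> 'a set set" assume "\<Theta> \<le> \<Theta>'"
    then have "F (unit_closure \<Theta>) v \<subseteq> F (unit_closure \<Theta>') v" for v
      using F unit_closure_mono unit_closure_U1 unfolding U1_monotone_def by metis
    then show "(F \<circ> unit_closure) \<Theta> \<le> (F \<circ> unit_closure) \<Theta>'" by (simp add: le_fun_def)
  qed
  have unf: "?L = F (unit_closure ?L)" using lfp_unfold[OF m] by simp
  \<comment> \<open>One unfolding exhibits the fixed point as a value of \<open>F\<close> on a
    family in \<open>U1\<close>; hence it lies in \<open>U1\<close>, where the closure is the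
    identity.\<close>
  have LU: "?L v \<in> U1" for v by (subst unf) (rule F1[OF unit_closure_U1])
  have fx: "F ?L = ?L" using unf unit_closure_id[of ?L, OF LU] by simp
  have least: "?L \<le> \<Theta>" if "\<And>v. \<Theta> v \<in> U1" "F \<Theta> = \<Theta>" for \<Theta>
    by (rule lfp_lowerbound) (simp add: unit_closure_id that)
  have eq: "least_fixpoint setobj F = ?L"
    unfolding least_fixpoint_def setobj_simps
  proof (rule the_equality)
    show "?L \<in> UNIV \<rightarrow> U1 \<and> F ?L = ?L \<and>
      (\<forall>\<Theta>'. \<Theta>' \<in> UNIV \<rightarrow> U1 \<and> F \<Theta>' = \<Theta>' \<longrightarrow> (\<forall>v. ?L v \<subseteq> \<Theta>' v))"
      using LU fx least by (auto simp: le_fun_def)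
    show "\<Theta> = ?L" if "\<Theta> \<in> UNIV \<rightarrow> U1 \<and> F \<Theta> = \<Theta> \<and>
      (\<forall>\<Theta>'. \<Theta>' \<in> UNIV \<rightarrow> U1 \<and> F \<Theta>' = \<Theta>' \<longrightarrow> (\<forall>v. \<Theta> v \<subseteq> \<Theta>' v))" for \<Theta>
    proof (rule antisym)
      show "\<Theta> \<le> ?L" using that LU fx by (simp add: le_fun_def)
      show "?L \<le> \<Theta>" using that by (intro least) auto
    qed
  qed
  show "least_fixpoint setobj F = ?L" by (rule eq)
  show "\<And>v. least_fixpoint setobj F v \<in> U1" unfolding eq by (rule LU)
  show "F (least_fixpoint setobj F) = least_fixpoint setobj F" unfolding eq by (rule fx)
qed

text \<open>\<open>unit_closure\<close> feeds both operators only arguments in \<open>U1\<close>, so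
  comparing them there already orders the two values of \<open>lfp\<close>.\<close>

lemma least_fixpoint_setobj_mono:
  assumes "U1_monotone F" "U1_monotone G"
    and "\<And>\<Theta> v. (\<And>u. \<Theta> u \<in> U1) \<Longrightarrow> F \<Theta> v \<subseteq> G \<Theta> v"
  shows "least_fixpoint setobj F v \<subseteq> least_fixpoint setobj G v"
proof -
  have "lfp (F \<circ> unit_closure) \<le> lfp (G \<circ> unit_closure)"
    by (rule lfp_mono) (simp add: le_fun_def assms(3) unit_closure_U1)
  then show ?thesis using assms(1,2) by (simp add: least_fixpoint_setobj(1) le_fun_def)
qed

section \<open>The algorithmic system as a monotone operation on \<open>U1\<close>\<close>

definition while_step ::
  "('e \<Rightarrow> 'v set) \<Rightarrow> 'e \<Rightarrow> ('v, 'e) com \<Rightarrow> 'v set set \<Rightarrow> ('v \<Rightarrow> 'v set set)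
    \<Rightarrow> ('v \<Rightarrow> 'v set set) \<Rightarrow> 'v \<Rightarrow> 'v set set" where
  "while_step fv E C p \<Gamma> =
    (\<lambda>\<Theta> x. \<Gamma> x \<union> alg fv setobj C (p \<otimes>\<^bsub>setobj\<^esub> texpr fv setobj E \<Theta>) \<Theta> x)"

lemma alg_setobj_If:
  "alg fv setobj (If E C1 C2) p \<Gamma> x =
    (if x \<in> asgn C1 \<union> asgn C2
     then texpr fv setobj E \<Gamma> \<otimes>\<^bsub>setobj\<^esub>
       (alg fv setobj C1 (p \<otimes>\<^bsub>setobj\<^esub> texpr fv setobj E \<Gamma>) \<Gamma> x \<union>
        alg fv setobj C2 (p \<otimes>\<^bsub>setobj\<^esub> texpr fv setobj E \<Gamma>) \<Gamma> x)
     else \<Gamma> x)"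
  by (simp add: Let_def setobj_simps)

lemma alg_setobj_While:
  "alg fv setobj (While E C) p \<Gamma> x =
    (let \<Gamma>s = least_fixpoint setobj (while_step fv E C p \<Gamma>)
     in if x \<in> asgn C then qstar setobj (texpr fv setobj E \<Gamma>s) \<otimes>\<^bsub>setobj\<^esub> \<Gamma>s x else \<Gamma>s x)"
  by (simp add: Let_def setobj_simps while_step_def)

lemma U1_texpr:
  fixes fv :: "'e \<Rightarrow> 'v::finite set"
  shows "(\<And>v. \<Gamma> v \<in> U1) \<Longrightarrow> texpr fv setobj E \<Gamma> \<in> U1"
  unfolding texpr_def by (rule U1_finprod) auto

lemma texpr_setobj_mono:
  fixes fv :: "'e \<Rightarrow> 'v::finite set"
  assumes "\<And>v. \<Gamma> v \<in> U1" "\<And>v. \<Gamma>' v \<in> U1" "\<And>v. \<Gamma> v \<subseteq> \<Gamma>' v"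
  shows "texpr fv setobj E \<Gamma> \<subseteq> texpr fv setobj E \<Gamma>'"
  unfolding texpr_def by (rule setobj_finprod_mono) (auto simp: assms)

text \<open>The two claims need a joint induction: for a loop, even membership in \<open>U1\<close>
  depends on the least fixed point existing, which rests on monotonicity of the body.\<close>

lemma alg_setobj:
  fixes fv :: "'e \<Rightarrow> 'v::finite set"
    and p p' :: "'v set set" and \<Gamma> \<Gamma>' :: "'v \<Rightarrow> 'v set set"
  shows "\<lbrakk>p \<in> U1; \<And>v. \<Gamma> v \<in> U1\<rbrakk> \<Longrightarrow> alg fv setobj C p \<Gamma> x \<in> U1"
    and "\<lbrakk>p \<in> U1; \<And>v. \<Gamma> v \<in> U1; p' \<in> U1; \<And>v. \<Gamma>' v \<in> U1; p \<subseteq> p'; \<And>v. \<Gamma> v \<subseteq> \<Gamma>' v\<rbrakk>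
      \<Longrightarrow> alg fv setobj C p \<Gamma> x \<subseteq> alg fv setobj C p' \<Gamma>' x"
proof (induction C arbitrary: p p' \<Gamma> \<Gamma>' x)
  case Skip
  { case 1 then show ?case by simp next case 2 then show ?case by simp }
next
  case (Assign y E)
  { case 1 then show ?case by (simp add: U1_mult U1_texpr)
  next
    case 2
    have "texpr fv setobj E \<Gamma> \<subseteq> texpr fv setobj E \<Gamma>'" by (rule texpr_setobj_mono) fact+
    with 2 show ?case by (simp add: setobj_mult_mono) }
next
  case (Seq C1 C2)
  { case 1 then show ?case by (simp add: Seq.IH)
  next
    case 2 then show ?case by (simp add: Seq.IH) }
next
  case (If E C1 C2)
  { case 1 then show ?case
      unfolding alg_setobj_If by (simp add: If.IH U1_mult U1_texpr U1_Un)
  next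
    case 2
    have t: "texpr fv setobj E \<Gamma> \<subseteq> texpr fv setobj E \<Gamma>'" by (rule texpr_setobj_mono) fact+
    have pt: "p \<otimes>\<^bsub>setobj\<^esub> texpr fv setobj E \<Gamma> \<subseteq> p' \<otimes>\<^bsub>setobj\<^esub> texpr fv setobj E \<Gamma>'"
      using 2(5) t by (rule setobj_mult_mono)
    have i1: "alg fv setobj C1 (p \<otimes>\<^bsub>setobj\<^esub> texpr fv setobj E \<Gamma>) \<Gamma> x
        \<subseteq> alg fv setobj C1 (p' \<otimes>\<^bsub>setobj\<^esub> texpr fv setobj E \<Gamma>') \<Gamma>' x"
      by (rule If.IH(2)) (intro 2 pt U1_mult U1_texpr)+
    have i2: "alg fv setobj C2 (p \<otimes>\<^bsub>setobj\<^esub> texpr fv setobj E \<Gamma>) \<Gamma> x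
        \<subseteq> alg fv setobj C2 (p' \<otimes>\<^bsub>setobj\<^esub> texpr fv setobj E \<Gamma>') \<Gamma>' x"
      by (rule If.IH(4)) (intro 2 pt U1_mult U1_texpr)+
    show ?case
      unfolding alg_setobj_If using setobj_mult_mono[OF t Un_mono[OF i1 i2]] 2(6) by simp }
next
  case (While E C)
  have step1: "while_step fv E C p \<Gamma> \<Theta> v \<in> U1"
    if "p \<in> U1" "\<And>v. \<Gamma> v \<in> U1" "\<And>v. \<Theta> v \<in> U1" for p \<Gamma> \<Theta> v
    unfolding while_step_def by (intro U1_Un While.IH(1) U1_mult U1_texpr that)
  \<comment> \<open>Parameters and fixed-point variable grow together: fixing the former gives
    monotonicity of one operator, fixing the latter compares the operators of two
    environments.\<close>
  have step2: "while_step fv E C p \<Gamma> \<Theta> v \<subseteq> while_step fv E C p' \<Gamma>' \<Theta>' v"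
    if "p \<in> U1" "p' \<in> U1" "\<And>v. \<Theta> v \<in> U1" "\<And>v. \<Theta>' v \<in> U1"
      "p \<subseteq> p'" "\<And>v. \<Gamma> v \<subseteq> \<Gamma>' v" "\<And>v. \<Theta> v \<subseteq> \<Theta>' v" for p p' \<Gamma> \<Gamma>' \<Theta> \<Theta>' v
    unfolding while_step_def
    by (intro Un_mono While.IH(2) U1_mult U1_texpr setobj_mult_mono texpr_setobj_mono that)
  have step: "U1_monotone (while_step fv E C p \<Gamma>)" if "p \<in> U1" "\<And>v. \<Gamma> v \<in> U1" for p \<Gamma>
    unfolding U1_monotone_def
    by (intro conjI allI impI step1 step2 that) auto
  { case 1
    note s = step[OF 1]
    show ?case
      unfolding alg_setobj_While Let_def
      using least_fixpoint_setobj(2)[OF s] by (simp add: U1_mult U1_qstar U1_texpr)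
  next
    case 2
    note s = step[OF 2(1,2)] and s' = step[OF 2(3,4)]
    have le: "least_fixpoint setobj (while_step fv E C p \<Gamma>) v
        \<subseteq> least_fixpoint setobj (while_step fv E C p' \<Gamma>') v" for v
      using 2 by (intro least_fixpoint_setobj_mono[OF s s'] step2) auto
    then show ?case
      unfolding alg_setobj_While Let_def
      using least_fixpoint_setobj(2)[OF s] least_fixpoint_setobj(2)[OF s']
      by (simp add: setobj_mult_mono setobj_qstar_mono texpr_setobj_mono) }
qed

text \<open>The loop case of \<open>alg_setobj\<close> obtains this from induction hypotheses; with
  that induction complete it holds for every body, and \<open>least_fixpoint_setobj\<close> can be
  applied in the soundness proof.\<close>

lemma U1_monotone_while_step:
  fixes fv :: "'e \<Rightarrow> 'v::finite set"
  assumes p: "p \<in> U1" and \<Gamma>: "\<And>v. \<Gamma> v \<in> U1"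
  shows "U1_monotone (while_step fv E C p \<Gamma>)"
  unfolding U1_monotone_def while_step_def
proof (intro conjI allI impI)
  fix \<Theta> :: "'v \<Rightarrow> 'v set set" and v assume \<Theta>: "\<forall>u. \<Theta> u \<in> U1"
  then have \<Theta>': "\<Theta> u \<in> U1" for u by simp
  have t: "p \<otimes>\<^bsub>setobj\<^esub> texpr fv setobj E \<Theta> \<in> U1" by (intro U1_mult p U1_texpr \<Theta>')
  show "\<Gamma> v \<union> alg fv setobj C (p \<otimes>\<^bsub>setobj\<^esub> texpr fv setobj E \<Theta>) \<Theta> v \<in> U1"
    by (intro U1_Un \<Gamma> alg_setobj(1) t \<Theta>')
  fix \<Xi> :: "'v \<Rightarrow> 'v set set" assume \<Xi>: "\<forall>u. \<Xi> u \<in> U1" and le: "\<forall>u. \<Theta> u \<subseteq> \<Xi> u"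
  then have \<Xi>': "\<Xi> u \<in> U1" "\<Theta> u \<subseteq> \<Xi> u" for u by simp_all
  have "alg fv setobj C (p \<otimes>\<^bsub>setobj\<^esub> texpr fv setobj E \<Theta>) \<Theta> v
      \<subseteq> alg fv setobj C (p \<otimes>\<^bsub>setobj\<^esub> texpr fv setobj E \<Xi>) \<Xi> v"
    by (intro alg_setobj(2) t \<Theta>' \<Xi>' U1_mult p U1_texpr setobj_mult_mono subset_refl texpr_setobj_mono)
  then show "\<Gamma> v \<union> alg fv setobj C (p \<otimes>\<^bsub>setobj\<^esub> texpr fv setobj E \<Theta>) \<Theta> v
      \<subseteq> \<Gamma> v \<union> alg fv setobj C (p \<otimes>\<^bsub>setobj\<^esub> texpr fv setobj E \<Xi>) \<Xi> v"
    by blast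
qed

section \<open>Dependence on blocks\<close>

text \<open>The join of the \<open>P v\<close> in the information order, where finer relations are
  higher. The factor \<open>D \<times> D\<close> makes empty \<open>X\<close> yield the total
  relation.\<close>

definition meet_rel :: "'d set \<Rightarrow> ('v \<Rightarrow> ('d \<times> 'd) set) \<Rightarrow> 'v set \<Rightarrow> ('d \<times> 'd) set" where
  "meet_rel D P X = D \<times> D \<inter> (\<Inter>v\<in>X. P v)"

lemma meet_rel_antimono: "X \<subseteq> Y \<Longrightarrow> meet_rel D P Y \<subseteq> meet_rel D P X"
  unfolding meet_rel_def by blast

lemma meet_rel_LoI: "(\<And>v. v \<in> X \<Longrightarrow> P v \<in> LoI D) \<Longrightarrow> meet_rel D P X \<in> LoI D"
proof (rule LoI_eqI)
  assume P: "\<And>v. v \<in> X \<Longrightarrow> P v \<in> LoI D"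
  show "meet_rel D P X \<subseteq> D \<times> D" unfolding meet_rel_def by blast
  show "(d, d) \<in> meet_rel D P X" if "d \<in> D" for d
    using that LoI_D(2)[OF P] unfolding meet_rel_def by blast
  show "(e, d) \<in> meet_rel D P X" if "(d, e) \<in> meet_rel D P X" for d e
    using that LoI_D(3)[OF P] unfolding meet_rel_def by blast
  show "(d, k) \<in> meet_rel D P X"
    if de: "(d, e) \<in> meet_rel D P X" and ek: "(e, k) \<in> meet_rel D P X" for d e k
  proof -
    have "(d, k) \<in> P v" if "v \<in> X" for v
      using de ek that LoI_D(4)[OF P[OF that], of d e k] unfolding meet_rel_def by blast
    then show ?thesis using de ek unfolding meet_rel_def by blast
  qed
qed

text \<open>The choice \<open>c\<close> cuts \<open>D\<close> into blocks, each a cell of \<open>meet_rel D P X\<close> for some \<open>X \<in> XX\<close>. The total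
  function \<open>h\<close> extends \<open>f\<close> so that branching on the value of \<open>f\<close> is meaningful on the whole block, even
  where \<open>f\<close> is undefined.\<close>

definition dep ::
  "'d set \<Rightarrow> ('v \<Rightarrow> ('d \<times> 'd) set) \<Rightarrow> 'v set set \<Rightarrow> ('d \<rightharpoonup> 'b) \<Rightarrow> bool" where
  "dep D P XX f \<longleftrightarrow> (\<exists>c h. \<forall>d\<in>D. c d \<in> XX \<and> (\<forall>y. f d = Some y \<longrightarrow> h d = y) \<and>
    (\<forall>d'. (d, d') \<in> meet_rel D P (c d) \<longrightarrow> c d' = c d \<and> h d' = h d))"

lemma depI:
  assumes "\<And>d. d \<in> D \<Longrightarrow> c d \<in> XX" "\<And>d y. \<lbrakk>d \<in> D; f d = Some y\<rbrakk> \<Longrightarrow> h d = y"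
    "\<And>d d'. (d, d') \<in> meet_rel D P (c d) \<Longrightarrow> c d' = c d \<and> h d' = h d"
  shows "dep D P XX f"
  unfolding dep_def using assms by (intro exI[of _ c] exI[of _ h]) blast

lemma depE:
  assumes "dep D P XX f"
  obtains c h where "\<And>d. d \<in> D \<Longrightarrow> c d \<in> XX" "\<And>d y. \<lbrakk>d \<in> D; f d = Some y\<rbrakk> \<Longrightarrow> h d = y"
    "\<And>d d'. (d, d') \<in> meet_rel D P (c d) \<Longrightarrow> c d' = c d"
    "\<And>d d'. (d, d') \<in> meet_rel D P (c d) \<Longrightarrow> h d' = h d"
proof -
  obtain c h where *: "\<And>d. d \<in> D \<Longrightarrow> c d \<in> XX \<and> (\<forall>y. f d = Some y \<longrightarrow> h d = y) \<and>
    (\<forall>d'. (d, d') \<in> meet_rel D P (c d) \<longrightarrow> c d' = c d \<and> h d' = h d)"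
    using assms unfolding dep_def by blast
  moreover have "d \<in> D" if "(d, d') \<in> meet_rel D P X" for d d' X
    using that unfolding meet_rel_def by blast
  ultimately show thesis by (intro that[of c h]) blast+
qed

text \<open>The same \<open>c\<close> and \<open>h\<close> serve: more choices are allowed, and
  \<open>h\<close> has to match a function with no new values.\<close>

lemma dep_weaken:
  assumes dep: "dep D P XX f" and sub: "XX \<subseteq> YY" and f': "\<And>d y. f' d = Some y \<Longrightarrow> f d = Some y"
  shows "dep D P YY f'"
proof -
  obtain c h where "\<And>d. d \<in> D \<Longrightarrow> c d \<in> XX" "\<And>d y. \<lbrakk>d \<in> D; f d = Some y\<rbrakk> \<Longrightarrow> h d = y"
    "\<And>d d'. (d, d') \<in> meet_rel D P (c d) \<Longrightarrow> c d' = c d"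
    "\<And>d d'. (d, d') \<in> meet_rel D P (c d) \<Longrightarrow> h d' = h d" using dep by (rule depE) blast
  with sub f' show ?thesis by (intro depI[of D c YY f' h P]) blast+
qed

lemma dep_mono: "\<lbrakk>dep D P XX f; XX \<subseteq> YY\<rbrakk> \<Longrightarrow> dep D P YY f"
  by (rule dep_weaken)

lemma dep_restrict:
  "\<lbrakk>dep D P XX f; \<And>d y. f' d = Some y \<Longrightarrow> f d = Some y\<rbrakk> \<Longrightarrow> dep D P XX f'"
  by (rule dep_weaken[OF _ subset_refl])

text \<open>Gluing the chosen blocks gives one relation \<open>R\<close> whose cells are cells of
  various \<open>meet_rel D P X\<close>. Hence \<open>R\<close> lies in the mix, and
  \<open>h\<close> is constant on its cells.\<close>

lemma dep_determines:
  assumes P: "\<And>v. P v \<in> LoI D" and dep: "dep D P XX f"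
  shows "determines f (tc D (meet_rel D P ` XX))"
proof -
  obtain c h where c: "\<And>d. d \<in> D \<Longrightarrow> c d \<in> XX" "\<And>d y. \<lbrakk>d \<in> D; f d = Some y\<rbrakk> \<Longrightarrow> h d = y"
    "\<And>d d'. (d, d') \<in> meet_rel D P (c d) \<Longrightarrow> c d' = c d"
    "\<And>d d'. (d, d') \<in> meet_rel D P (c d) \<Longrightarrow> h d' = h d" using dep by (rule depE) blast
  \<comment> \<open>\<open>R\<close> uses the choice made at its first argument; constancy of
    \<open>c\<close> on blocks makes this symmetric and transitive.\<close>
  define R where "R = {(d, d'). (d, d') \<in> meet_rel D P (c d)}"
  note M = meet_rel_LoI[of _ P D, OF P]
  have RL: "R \<in> LoI D"
  proof (rule LoI_eqI)
    show "R \<subseteq> D \<times> D" unfolding R_def meet_rel_def by blast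
    show "(d, d) \<in> R" if "d \<in> D" for d
      using LoI_D(2)[OF M that] unfolding R_def by blast
    show "(e, d) \<in> R" if "(d, e) \<in> R" for d e
      using that c(3) LoI_D(3)[OF M, of d e] unfolding R_def by auto
    show "(d, k) \<in> R" if "(d, e) \<in> R" "(e, k) \<in> R" for d e k
      using that c(3)[of d e] LoI_D(4)[OF M, of d e _ k] unfolding R_def by auto
  qed
  have sub: "meet_rel D P ` XX \<subseteq> LoI D" using M by blast
  have "R `` {d} = meet_rel D P (c d) `` {d}" for d unfolding R_def by blast
  then have "R \<in> mix D (meet_rel D P ` XX)"
    unfolding mix_iff[OF sub] using RL c(1) by blast
  then have "R \<in> tc D (meet_rel D P ` XX)" using RL unfolding tc_def by blast
  moreover have "f d = f d'" if "(d, d') \<in> R" "d \<in> dom f" "d' \<in> dom f" for d d'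
  proof -
    have "d \<in> D" "d' \<in> D" using that(1) LoI_D(1)[OF RL] by blast+
    moreover have "h d' = h d" using that(1) c(4) unfolding R_def by blast
    moreover obtain y y' where "f d = Some y" "f d' = Some y'"
      using \<open>d \<in> dom f\<close> \<open>d' \<in> dom f\<close> by blast
    ultimately show ?thesis using c(2)[of d y] c(2)[of d' y'] by simp
  qed
  ultimately show ?thesis unfolding determines_def by (intro bexI[of _ R]) auto
qed

text \<open>The constant choice \<open>{v}\<close> suffices: on each cell of \<open>P v\<close> the
  partial function takes at most one value, which extends to the whole cell.\<close>

lemma dep_gen:
  assumes P: "P v \<in> LoI D"
    and f: "\<And>d d'. \<lbrakk>(d, d') \<in> P v; d \<in> dom f; d' \<in> dom f\<rbrakk> \<Longrightarrow> f d = f d'"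
  shows "dep D P (gen v) f"
proof -
  \<comment> \<open>Reads the value that \<open>f\<close> takes anywhere in the cell of
    \<open>d\<close>. If \<open>f\<close> is undefined on the whole cell the value is unspecified,
    but still depends on the cell only.\<close>
  define h where "h d = (THE y. \<exists>e. (d, e) \<in> P v \<and> f e = Some y)" for d
  show ?thesis
  proof (rule depI[where c = "\<lambda>_. {v}" and h = h])
    show "{v} \<in> gen v" by (simp add: gen_def down_def)
    show "h d = y" if "d \<in> D" "f d = Some y" for d y
      unfolding h_def
    proof (rule the_equality)
      show "\<exists>e. (d, e) \<in> P v \<and> f e = Some y" using that LoI_D(2)[OF P] by blast
      show "z = y" if "\<exists>e. (d, e) \<in> P v \<and> f e = Some z" for z
        using that f[of d] \<open>f d = Some y\<close> by force
    qed
    show "{v} = {v} \<and> h d' = h d" if "(d, d') \<in> meet_rel D P {v}" for d d'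
    proof -
      have dd: "(d, d') \<in> P v" using that by (simp add: meet_rel_def)
      have "(d, e) \<in> P v \<longleftrightarrow> (d', e) \<in> P v" for e
        using LoI_D(4)[OF P, of d d' e] LoI_D(4)[OF P, of d' d e] LoI_D(3)[OF P dd] dd by blast
      then show ?thesis by (simp add: h_def)
    qed
  qed
qed

text \<open>Take the union of the sets chosen for the single variables: its blocks refine those of
  each variable, so all components are constant at once. The map \<open>q\<close> covers both
  expression values and restricted stores.\<close>

lemma dep_finprod:
  assumes A: "finite A" and \<Gamma>: "\<And>v. v \<in> A \<Longrightarrow> \<Gamma> v \<in> carrier setobj"
    and dep: "\<And>v. v \<in> A \<Longrightarrow> dep D P (\<Gamma> v) (\<lambda>d. map_option (\<lambda>s. s v) (F d))"
    and q: "\<And>s s'. (\<And>v. v \<in> A \<Longrightarrow> s v = s' v) \<Longrightarrow> q s = q s'"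
  shows "dep D P (finprod setobj \<Gamma> A) (\<lambda>d. map_option q (F d))"
proof -
  have "\<forall>v\<in>A. \<exists>c h. \<forall>d\<in>D. c d \<in> \<Gamma> v \<and>
    (\<forall>y. map_option (\<lambda>s. s v) (F d) = Some y \<longrightarrow> h d = y) \<and>
    (\<forall>d'. (d, d') \<in> meet_rel D P (c d) \<longrightarrow> c d' = c d \<and> h d' = h d)"
    using dep unfolding dep_def by (rule ballI)
  from bchoice[OF this] obtain c where "\<forall>v\<in>A. \<exists>h. \<forall>d\<in>D. c v d \<in> \<Gamma> v \<and>
    (\<forall>y. map_option (\<lambda>s. s v) (F d) = Some y \<longrightarrow> h d = y) \<and>
    (\<forall>d'. (d, d') \<in> meet_rel D P (c v d) \<longrightarrow> c v d' = c v d \<and> h d' = h d)" by (rule exE)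
  from bchoice[OF this] obtain h where ch: "\<forall>v\<in>A. \<forall>d\<in>D. c v d \<in> \<Gamma> v \<and>
    (\<forall>y. map_option (\<lambda>s. s v) (F d) = Some y \<longrightarrow> h v d = y) \<and>
    (\<forall>d'. (d, d') \<in> meet_rel D P (c v d) \<longrightarrow> c v d' = c v d \<and> h v d' = h v d)" by (rule exE)
  show ?thesis
  proof (rule depI)
    show "(\<Union>v\<in>A. c v d) \<in> finprod setobj \<Gamma> A" if "d \<in> D" for d
    proof (rule mem_setobj_finprod[THEN iffD2, OF A])
      show "\<Gamma> v \<in> carrier setobj" if "v \<in> A" for v using that by (rule \<Gamma>)
      show "\<exists>f. (\<forall>v\<in>A. f v \<in> \<Gamma> v) \<and> (\<Union>v\<in>A. c v d) \<subseteq> (\<Union>v\<in>A. f v)"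
        using ch that by (intro exI[of _ "\<lambda>v. c v d"]) blast
    qed
    \<comment> \<open>The assembled store \<open>\<lambda>v. h v d\<close> agrees with the actual
      one only on \<open>A\<close>, which is all that \<open>q\<close> inspects.\<close>
    show "q (\<lambda>v. h v d) = y" if d: "d \<in> D" and y: "map_option q (F d) = Some y" for d y
    proof -
      obtain s where s: "F d = Some s" "y = q s" using y by auto
      have "q (\<lambda>v. h v d) = q s"
      proof (rule q[of "\<lambda>v. h v d" s])
        show "h v d = s v" if "v \<in> A" for v using ch that d s(1) by (metis option.map(2))
      qed
      then show ?thesis using s(2) by simp
    qed
    show "(\<Union>v\<in>A. c v d') = (\<Union>v\<in>A. c v d) \<and> q (\<lambda>v. h v d') = q (\<lambda>v. h v d)"
      if m: "(d, d') \<in> meet_rel D P (\<Union>v\<in>A. c v d)" for d d'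
    proof -
      have "d \<in> D" using m unfolding meet_rel_def by blast
      moreover have "(d, d') \<in> meet_rel D P (c v d)" if "v \<in> A" for v
        using m that meet_rel_antimono[of "c v d" "\<Union>v\<in>A. c v d" D P] by blast
      ultimately have same: "c v d' = c v d" "h v d' = h v d" if "v \<in> A" for v
        using ch that by blast+
      have "q (\<lambda>v. h v d') = q (\<lambda>v. h v d)"
        by (rule q[of "\<lambda>v. h v d'" "\<lambda>v. h v d"]) (rule same(2))
      then show ?thesis using same(1) by simp
    qed
  qed
qed

section \<open>Soundness of the algorithmic system\<close>

lemma sem_eq_Some: "sem eval test C s = Some t \<longleftrightarrow> big_step eval test C s t"
proof
  have the: "(THE t. big_step eval test C s t) = u" if "big_step eval test C s u" for u
    using that by (auto intro: big_step_deterministic)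
  show "big_step eval test C s t" if "sem eval test C s = Some t"
    using that the unfolding sem_def by (auto split: if_splits)
  show "sem eval test C s = Some t" if "big_step eval test C s t"
    using that the[OF that] unfolding sem_def by auto
qed

lemma sem_Skip: "sem eval test Skip \<circ>\<^sub>m F = F"
proof -
  have "sem eval test Skip s = Some s" for s
    unfolding sem_eq_Some by (rule big_step.Skip)
  then show ?thesis by (simp add: map_comp_def fun_eq_iff split: option.split)
qed

lemma sem_comp_eq_Some:
  "(sem eval test C \<circ>\<^sub>m F) d = Some t \<longleftrightarrow> (\<exists>s. F d = Some s \<and> big_step eval test C s t)"
  by (auto simp: map_comp_def sem_eq_Some split: option.splits)

lemma big_step_unassigned:
  "\<lbrakk>big_step eval test C s t; x \<notin> asgn C\<rbrakk> \<Longrightarrow> t x = s x"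
  by (induction rule: big_step.induct) auto

text \<open>Numbering the states of a terminating run lets different secrets be compared at the same
  iteration.\<close>

lemma big_step_While_trace:
  assumes "big_step eval test (While E C) s t"
  shows "\<exists>n r. r 0 = s \<and> r n = t \<and> \<not> test (eval E t) \<and>
    (\<forall>k<n. test (eval E (r k)) \<and> big_step eval test C (r k) (r (Suc k)))"
  using assms
proof (induction "While E C" s t rule: big_step.induct)
  case (WhileFalse s)
  then show ?case by (intro exI[of _ 0] exI[of _ "\<lambda>_. s"]) simp
next
  case (WhileTrue s s' s'')
  then obtain n r where r: "r 0 = s'" "r n = s''" "\<not> test (eval E s'')"
    "\<forall>k<n. test (eval E (r k)) \<and> big_step eval test C (r k) (r (Suc k))" by blast
  show ?case
    using r WhileTrue(1,2)
    by (intro exI[of _ "Suc n"] exI[of _ "case_nat s r"]) (auto split: nat.splits simp: less_Suc_eq_0_disj)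
qed

text \<open>The invariant of the soundness induction, with \<open>F\<close> sending a secret to the
  store reached so far, undefined where none is reached.\<close>

definition env_dep ::
  "'d set \<Rightarrow> ('v \<Rightarrow> ('d \<times> 'd) set) \<Rightarrow> ('v \<Rightarrow> 'v set set) \<Rightarrow> ('d \<rightharpoonup> ('v \<Rightarrow> 'val)) \<Rightarrow> bool" where
  "env_dep D P \<Gamma> F \<longleftrightarrow> (\<forall>v. dep D P (\<Gamma> v) (\<lambda>d. map_option (\<lambda>s. s v) (F d)))"

lemma env_depD: "env_dep D P \<Gamma> F \<Longrightarrow> dep D P (\<Gamma> v) (\<lambda>d. map_option (\<lambda>s. s v) (F d))"
  by (simp add: env_dep_def)

lemma env_dep_mono: "\<lbrakk>env_dep D P \<Gamma> F; \<And>v. \<Gamma> v \<subseteq> \<Gamma>' v\<rbrakk> \<Longrightarrow> env_dep D P \<Gamma>' F"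
  unfolding env_dep_def by (blast intro: dep_mono)

text \<open>A run is determined by the blocks of the guards met along it, up to and including the first
  false one, and by the block of \<open>x\<close> at that point. On a block where the guard never fails infinitely
  many cells are met, but finitely many variables.\<close>

lemma dep_loop:
  fixes XX :: "'v::finite set set"
  assumes guard: "\<And>k::nat. dep D P TT (\<lambda>d. map_option b (F k d))"
    and var: "\<And>k. dep D P XX (\<lambda>d. map_option a (F k d))"
    and XX: "{} \<in> XX"
    and f: "\<And>d y. \<lbrakk>d \<in> D; f d = Some y\<rbrakk> \<Longrightarrow> \<exists>n. \<exists>r. (\<forall>k\<le>n. F k d = Some (r k)) \<and>
      (\<forall>k<n. test (b (r k))) \<and> \<not> test (b (r n)) \<and> y = a (r n)"
  shows "dep D P (qstar setobj TT \<otimes>\<^bsub>setobj\<^esub> XX) f"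
proof -
  have "\<forall>k. \<exists>c h. \<forall>d\<in>D. c d \<in> TT \<and> (\<forall>y. map_option b (F k d) = Some y \<longrightarrow> h d = y) \<and>
    (\<forall>d'. (d, d') \<in> meet_rel D P (c d) \<longrightarrow> c d' = c d \<and> h d' = h d)"
    using guard unfolding dep_def by blast
  then obtain ct ht where t: "\<And>k d. d \<in> D \<Longrightarrow> ct k d \<in> TT \<and>
      (\<forall>y. map_option b (F k d) = Some y \<longrightarrow> ht k d = y) \<and>
      (\<forall>d'. (d, d') \<in> meet_rel D P (ct k d) \<longrightarrow> ct k d' = ct k d \<and> ht k d' = ht k d)"
    by metis
  have "\<forall>k. \<exists>c h. \<forall>d\<in>D. c d \<in> XX \<and> (\<forall>y. map_option a (F k d) = Some y \<longrightarrow> h d = y) \<and>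
    (\<forall>d'. (d, d') \<in> meet_rel D P (c d) \<longrightarrow> c d' = c d \<and> h d' = h d)"
    using var unfolding dep_def by blast
  then obtain cx hx where x: "\<And>k d. d \<in> D \<Longrightarrow> cx k d \<in> XX \<and>
      (\<forall>y. map_option a (F k d) = Some y \<longrightarrow> hx k d = y) \<and>
      (\<forall>d'. (d, d') \<in> meet_rel D P (cx k d) \<longrightarrow> cx k d' = cx k d \<and> hx k d' = hx k d)"
    by metis
  have t1: "ct k d \<in> TT" if "d \<in> D" for k d using t[OF that] by blast
  have t2: "ht k d = b s" if "d \<in> D" "F k d = Some s" for k d s
  proof -
    have "map_option b (F k d) = Some (b s)" using that(2) by simp
    then show ?thesis using t[OF that(1)] by blast
  qed
  have t3: "ct k d' = ct k d" "ht k d' = ht k d"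
    if "d \<in> D" "(d, d') \<in> meet_rel D P (ct k d)" for k d d' using t[OF that(1)] that(2) by blast+
  have x1: "cx k d \<in> XX" if "d \<in> D" for k d using x[OF that] by blast
  have x2: "hx k d = a s" if "d \<in> D" "F k d = Some s" for k d s
  proof -
    have "map_option a (F k d) = Some (a s)" using that(2) by simp
    then show ?thesis using x[OF that(1)] by blast
  qed
  have x3: "cx k d' = cx k d" "hx k d' = hx k d"
    if "d \<in> D" "(d, d') \<in> meet_rel D P (cx k d)" for k d d' using x[OF that(1)] that(2) by blast+
  \<comment> \<open>Indices of the guards evaluated from \<open>d\<close>: the true ones before the
    first failure and the failing one too, since only strictly earlier guards must hold.\<close>
  define K where "K d = {k. \<forall>j<k. test (ht j d)}" for d
  define stops where "stops d \<longleftrightarrow> (\<exists>n. \<not> test (ht n d))" for d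
  \<comment> \<open>Meaningful only under \<open>stops d\<close>, and used only there in
    \<open>c\<close> and in the extension of \<open>f\<close>.\<close>
  define N where "N d = (LEAST n. \<not> test (ht n d))" for d
  \<comment> \<open>The set read at exit is added only if the loop stops; otherwise the default
    \<open>{}\<close> must itself belong to \<open>XX\<close>.\<close>
  define c where "c d = (\<Union>k\<in>K d. ct k d) \<union> (if stops d then cx (N d) d else {})" for d
  have NK: "N d \<in> K d" for d
    unfolding K_def N_def using not_less_Least by blast
  show ?thesis
  proof (rule depI[where c = c and h = "\<lambda>d. if stops d then hx (N d) d else undefined"])
    show "c d \<in> qstar setobj TT \<otimes>\<^bsub>setobj\<^esub> XX" if d: "d \<in> D" for d
    proof -
      have "(\<Union>k\<in>K d. ct k d) \<in> qstar setobj TT"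
        \<comment> \<open>\<open>K d\<close> may be infinite, but the sets \<open>ct k d\<close> are
          drawn from the finitely many sets of variables.\<close>
        by (rule Union_in_qstar) (use t1[OF d] in auto)
      moreover have "(if stops d then cx (N d) d else {}) \<in> XX" using x1[OF d] XX by simp
      ultimately show ?thesis unfolding c_def by (rule setobj_multI)
    qed
    show "(if stops d then hx (N d) d else undefined) = y" if d: "d \<in> D" and y: "f d = Some y" for d y
    proof -
      obtain n r where r: "\<forall>k\<le>n. F k d = Some (r k)" "\<forall>k<n. test (b (r k))"
        "\<not> test (b (r n))" "y = a (r n)" using f[OF d y] by blast
      have ht: "ht k d = b (r k)" if "k \<le> n" for k using t2[OF d] r(1) that by simp
      have "N d = n" unfolding N_def
      proof (rule Least_equality)
        show "\<not> test (ht n d)" using ht r(3) by simp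
        show "n \<le> m" if "\<not> test (ht m d)" for m
          using that ht[of m] r(2) by (cases "m < n") auto
      qed
      moreover have "stops d" unfolding stops_def using ht[of n] r(3) by (intro exI[of _ n]) simp
      ultimately show ?thesis using x2[OF d] r(1,4) by simp
    qed
    show "c d' = c d \<and> (if stops d' then hx (N d') d' else undefined) =
        (if stops d then hx (N d) d else undefined)" if m: "(d, d') \<in> meet_rel D P (c d)" for d d'
    proof -
      have d: "d \<in> D" using m unfolding meet_rel_def by blast
      have "(d, d') \<in> meet_rel D P (ct k d)" if "k \<in> K d" for k
        using m that meet_rel_antimono[of "ct k d" "c d" D P] unfolding c_def by blast
      then have ht: "ct k d' = ct k d" "ht k d' = ht k d" if "k \<in> K d" for k
        using t3[OF d] that by blast+
      \<comment> \<open>Whether \<open>Suc k\<close> is reached depends on guard \<open>k\<close>,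
        whose value the block of \<open>d\<close> fixes once \<open>k\<close> is reached.\<close>
      have same: "k \<in> K d' \<longleftrightarrow> k \<in> K d" for k
      proof (induction k)
        case 0 show ?case by (simp add: K_def)
      next
        case (Suc k)
        have "Suc k \<in> K e \<longleftrightarrow> k \<in> K e \<and> test (ht k e)" for e
          by (auto simp: K_def less_Suc_eq)
        then show ?case using Suc ht(2) by auto
      qed
      then have KK: "K d' = K d" by blast
      show ?thesis
      proof (cases "stops d")
        case True
        then have n: "\<not> test (ht (N d) d)" unfolding stops_def N_def by (rule LeastI_ex)
        then have n': "\<not> test (ht (N d) d')" using ht(2)[OF NK] by simp
        then have True': "stops d'" unfolding stops_def by blast
        have "N d' = N d" unfolding N_def[of d']
        proof (rule Least_equality)
          show "\<not> test (ht (N d) d')" by (rule n')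
          show "N d \<le> m" if "\<not> test (ht m d')" for m
            using that NK[of d] unfolding KK[symmetric] unfolding K_def
            by (auto simp: not_less[symmetric])
        qed
        moreover have "(d, d') \<in> meet_rel D P (cx (N d) d)"
          using m True meet_rel_antimono[of "cx (N d) d" "c d" D P] unfolding c_def by auto
        then have "cx (N d) d' = cx (N d) d \<and> hx (N d) d' = hx (N d) d" using x3[OF d] by blast
        ultimately show ?thesis unfolding c_def KK using True True' ht(1) by auto
      next
        case False
        \<comment> \<open>Without a failing guard every index is evaluated, so all guard readings
          transfer to \<open>d'\<close> and it does not stop either.\<close>
        then have "K d = UNIV" unfolding K_def stops_def by blast
        then have "\<not> stops d'" using False ht(2) unfolding stops_def by auto
        then show ?thesis using False ht(1) unfolding c_def KK by auto
      qed
    qed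
  qed
qed

text \<open>A decision tree of depth one: the guard's block first, then the block of the branch it
  selects. Fixing the first block forces both secrets into the same branch.\<close>

lemma dep_branch:
  assumes g: "dep D P TT g" and f1: "dep D P XX1 f1" and f2: "dep D P XX2 f2"
    and f: "\<And>d y. f d = Some y \<Longrightarrow>
      \<exists>z. g d = Some z \<and> (if test z then f1 d = Some y else f2 d = Some y)"
  shows "dep D P (TT \<otimes>\<^bsub>setobj\<^esub> (XX1 \<union> XX2)) f"
proof -
  obtain c h where t: "\<And>d. d \<in> D \<Longrightarrow> c d \<in> TT" "\<And>d y. \<lbrakk>d \<in> D; g d = Some y\<rbrakk> \<Longrightarrow> h d = y"
    "\<And>d d'. (d, d') \<in> meet_rel D P (c d) \<Longrightarrow> c d' = c d"
    "\<And>d d'. (d, d') \<in> meet_rel D P (c d) \<Longrightarrow> h d' = h d" using g by (rule depE) blast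
  obtain c1 h1 where 1: "\<And>d. d \<in> D \<Longrightarrow> c1 d \<in> XX1"
    "\<And>d y. \<lbrakk>d \<in> D; f1 d = Some y\<rbrakk> \<Longrightarrow> h1 d = y"
    "\<And>d d'. (d, d') \<in> meet_rel D P (c1 d) \<Longrightarrow> c1 d' = c1 d"
    "\<And>d d'. (d, d') \<in> meet_rel D P (c1 d) \<Longrightarrow> h1 d' = h1 d" using f1 by (rule depE) blast
  obtain c2 h2 where 2: "\<And>d. d \<in> D \<Longrightarrow> c2 d \<in> XX2"
    "\<And>d y. \<lbrakk>d \<in> D; f2 d = Some y\<rbrakk> \<Longrightarrow> h2 d = y"
    "\<And>d d'. (d, d') \<in> meet_rel D P (c2 d) \<Longrightarrow> c2 d' = c2 d"
    "\<And>d d'. (d, d') \<in> meet_rel D P (c2 d) \<Longrightarrow> h2 d' = h2 d" using f2 by (rule depE) blast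
  define k where "k d = (if test (h d) then c1 d else c2 d)" for d
  show ?thesis
  proof (rule depI)
    show "c d \<union> k d \<in> TT \<otimes>\<^bsub>setobj\<^esub> (XX1 \<union> XX2)" if "d \<in> D" for d
      using t(1)[OF that] 1(1)[OF that] 2(1)[OF that] by (intro setobj_multI) (auto simp: k_def)
    show "(if test (h d) then h1 d else h2 d) = y" if "d \<in> D" "f d = Some y" for d y
      using f[OF that(2)] t(2)[OF that(1)] 1(2)[OF that(1)] 2(2)[OF that(1)]
      by (auto split: if_splits)
    show "c d' \<union> k d' = c d \<union> k d \<and>
        (if test (h d') then h1 d' else h2 d') = (if test (h d) then h1 d else h2 d)"
      if m: "(d, d') \<in> meet_rel D P (c d \<union> k d)" for d d'
    proof -
      have "(d, d') \<in> meet_rel D P (c d)" "(d, d') \<in> meet_rel D P (k d)"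
        using m meet_rel_antimono[of "c d" "c d \<union> k d" D P]
          meet_rel_antimono[of "k d" "c d \<union> k d" D P] by auto
      then show ?thesis
        using t(3,4)[of d d'] 1(3,4)[of d d'] 2(3,4)[of d d']
        by (cases "test (h d)") (simp_all add: k_def)
    qed
  qed
qed

lemma dep_texpr:
  fixes fv :: "'e \<Rightarrow> 'v::finite set" and eval :: "'e \<Rightarrow> ('v \<Rightarrow> 'val) \<Rightarrow> 'val"
  assumes lang: "expression_language fv eval tuple"
    and F: "env_dep D P \<Gamma> F" and \<Gamma>: "\<And>v. \<Gamma> v \<in> U1"
  shows "dep D P (texpr fv setobj E \<Gamma>) (\<lambda>d. map_option (eval E) (F d))"
  unfolding texpr_def
proof (rule dep_finprod[where \<Gamma> = \<Gamma> and F = F and q = "eval E", OF finite])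
  show "\<Gamma> v \<in> carrier setobj" for v by (rule U1_carrier, rule \<Gamma>)
  show "dep D P (\<Gamma> v) (\<lambda>d. map_option (\<lambda>s. s v) (F d))" for v by (rule env_depD, rule F)
  fix s s' :: "'v \<Rightarrow> 'val" assume "\<And>v. v \<in> fv E \<Longrightarrow> s v = s' v"
  then show "eval E s = eval E s'" by (rule expression_language.eval_cong[OF lang])
qed

text \<open>Generalising over \<open>F\<close> lets commands start from any intermediate partial
  store. Each constructor then reduces to closure properties of \<open>dep\<close>: tensors for
  expressions, \<open>dep_branch\<close>, \<open>dep_loop\<close>, and shrinking of the domain for
  unassigned variables.\<close>

lemma env_dep_alg:
  fixes fv :: "'e \<Rightarrow> 'v::finite set"
  assumes lang: "expression_language fv eval tuple"
  shows "\<lbrakk>p \<in> U1; \<And>v. \<Gamma> v \<in> U1; env_dep D P \<Gamma> F\<rbrakk>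
    \<Longrightarrow> env_dep D P (alg fv setobj C p \<Gamma>) (sem eval test C \<circ>\<^sub>m F)"
proof (induction C arbitrary: p \<Gamma> F)
  case Skip
  then show ?case by (simp add: sem_Skip)
next
  case (Assign x E)
  have t: "dep D P (texpr fv setobj E \<Gamma>) (\<lambda>d. map_option (eval E) (F d))"
    using Assign by (intro dep_texpr[OF lang]) auto
  show ?case
    unfolding env_dep_def
  proof
    fix v
    show "dep D P (alg fv setobj (Assign x E) p \<Gamma> v)
      (\<lambda>d. map_option (\<lambda>s. s v) ((sem eval test (Assign x E) \<circ>\<^sub>m F) d))"
    proof (cases "v = x")
      case True
      \<comment> \<open>\<open>p\<close> lies above the unit, so its factor only enlarges the
        permitted choices.\<close>
      have "dep D P (p \<otimes>\<^bsub>setobj\<^esub> texpr fv setobj E \<Gamma>) (\<lambda>d. map_option (eval E) (F d))"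
        using Assign by (intro dep_mono[OF t] setobj_mult_upper U1_texpr)
      then have "dep D P (p \<otimes>\<^bsub>setobj\<^esub> texpr fv setobj E \<Gamma>)
        (\<lambda>d. map_option (\<lambda>s. s v) ((sem eval test (Assign x E) \<circ>\<^sub>m F) d))"
        by (rule dep_restrict) (auto simp: sem_comp_eq_Some True elim: big_step_cases(2))
      then show ?thesis using True by simp
    next
      case False
      have "dep D P (\<Gamma> v) (\<lambda>d. map_option (\<lambda>s. s v) ((sem eval test (Assign x E) \<circ>\<^sub>m F) d))"
        by (rule dep_restrict[OF env_depD[OF Assign(3)]])
          (auto simp: sem_comp_eq_Some False elim!: big_step_cases(2))
      then show ?thesis using False by simp
    qed
  qed
next
  case (Seq C1 C2)
  have "env_dep D P (alg fv setobj C2 p (alg fv setobj C1 p \<Gamma>))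
      (sem eval test C2 \<circ>\<^sub>m (sem eval test C1 \<circ>\<^sub>m F))"
    using Seq.prems by (intro Seq.IH alg_setobj)
  from env_depD[OF this] have "dep D P (alg fv setobj C2 p (alg fv setobj C1 p \<Gamma>) v)
      (\<lambda>d. map_option (\<lambda>s. s v) ((sem eval test (Seq C1 C2) \<circ>\<^sub>m F) d))" for v
    by (rule dep_restrict) (force simp: sem_comp_eq_Some elim: big_step_cases(3))
  then show ?case by (simp add: env_dep_def)
next
  case (If E C1 C2)
  define t where "t = texpr fv setobj E \<Gamma>"
  have tU: "t \<in> U1" unfolding t_def by (rule U1_texpr) fact
  have t: "dep D P t (\<lambda>d. map_option (eval E) (F d))"
    unfolding t_def using If.prems by (intro dep_texpr[OF lang]) auto
  have b1: "env_dep D P (alg fv setobj C1 (p \<otimes>\<^bsub>setobj\<^esub> t) \<Gamma>) (sem eval test C1 \<circ>\<^sub>m F)"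
    by (rule If.IH(1)) (intro U1_mult tU If.prems)+
  have b2: "env_dep D P (alg fv setobj C2 (p \<otimes>\<^bsub>setobj\<^esub> t) \<Gamma>) (sem eval test C2 \<circ>\<^sub>m F)"
    by (rule If.IH(2)) (intro U1_mult tU If.prems)+
  show ?case
    unfolding env_dep_def
  proof
    fix x
    show "dep D P (alg fv setobj (If E C1 C2) p \<Gamma> x)
      (\<lambda>d. map_option (\<lambda>s. s x) ((sem eval test (If E C1 C2) \<circ>\<^sub>m F) d))" (is "dep D P ?X ?f")
    proof (cases "x \<in> asgn C1 \<union> asgn C2")
      case True
      have "dep D P (t \<otimes>\<^bsub>setobj\<^esub> (alg fv setobj C1 (p \<otimes>\<^bsub>setobj\<^esub> t) \<Gamma> x \<union>
          alg fv setobj C2 (p \<otimes>\<^bsub>setobj\<^esub> t) \<Gamma> x)) ?f"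
        using t env_depD[OF b1] env_depD[OF b2]
        by (rule dep_branch[where test = test])
          (fastforce simp: sem_comp_eq_Some elim!: big_step_cases(4))
      then show ?thesis using True unfolding alg_setobj_If t_def by simp
    next
      case False
      \<comment> \<open>An unassigned variable keeps its initial value, so the observation is the
        old one with a possibly smaller domain.\<close>
      have "dep D P (\<Gamma> x) ?f"
        by (rule dep_restrict[OF env_depD[OF If.prems(3)]])
          (use False in \<open>auto simp: sem_comp_eq_Some dest: big_step_unassigned\<close>)
      then show ?thesis using False unfolding alg_setobj_If by simp
    qed
  qed
next
  case (While E C)
  define \<Gamma>s where "\<Gamma>s = least_fixpoint setobj (while_step fv E C p \<Gamma>)"
  have mono: "U1_monotone (while_step fv E C p \<Gamma>)"
    by (rule U1_monotone_while_step) fact+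
  have \<Gamma>sU: "\<Gamma>s v \<in> U1" for v unfolding \<Gamma>s_def by (rule least_fixpoint_setobj(2)[OF mono])
  define t where "t = texpr fv setobj E \<Gamma>s"
  have tU: "t \<in> U1" unfolding t_def by (rule U1_texpr[OF \<Gamma>sU])
  have fx: "while_step fv E C p \<Gamma> \<Gamma>s = \<Gamma>s"
    unfolding \<Gamma>s_def by (rule least_fixpoint_setobj(3)[OF mono])
  have "\<Gamma> v \<union> alg fv setobj C (p \<otimes>\<^bsub>setobj\<^esub> t) \<Gamma>s v = \<Gamma>s v" for v
    using fun_cong[OF fx, of v] by (simp add: while_step_def t_def)
  \<comment> \<open>The fixed-point equation makes \<open>\<Gamma>s\<close> absorb both the initial
    environment and the result of one pass of the body.\<close>
  then have sub: "\<Gamma> v \<subseteq> \<Gamma>s v" "alg fv setobj C (p \<otimes>\<^bsub>setobj\<^esub> t) \<Gamma>s v \<subseteq> \<Gamma>s v" for v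
    by blast+
  \<comment> \<open>The partial store after \<open>k\<close> executions of the body, whatever the
    guard says; \<open>dep_loop\<close> picks the iteration at which the guard first fails.\<close>
  define G where "G k = ((\<lambda>G. sem eval test C \<circ>\<^sub>m G) ^^ k) F" for k :: nat
  have G: "env_dep D P \<Gamma>s (G k)" for k
  proof (induction k)
    case 0 show ?case using env_dep_mono[OF While.prems(3) sub(1)] by (simp add: G_def)
  next
    case (Suc k)
    have "env_dep D P (alg fv setobj C (p \<otimes>\<^bsub>setobj\<^esub> t) \<Gamma>s) (sem eval test C \<circ>\<^sub>m G k)"
      by (intro While.IH U1_mult While.prems tU \<Gamma>sU Suc)
    then show ?case using env_dep_mono[OF _ sub(2)] by (simp add: G_def)
  qed
  show ?case
    unfolding env_dep_def
  proof
    fix x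
    show "dep D P (alg fv setobj (While E C) p \<Gamma> x)
      (\<lambda>d. map_option (\<lambda>s. s x) ((sem eval test (While E C) \<circ>\<^sub>m F) d))" (is "dep D P ?X ?f")
    proof (cases "x \<in> asgn C")
      case True
      have "dep D P (qstar setobj t \<otimes>\<^bsub>setobj\<^esub> \<Gamma>s x) ?f"
      proof (rule dep_loop[where F = G and b = "eval E" and a = "\<lambda>s. s x" and test = test])
        show "dep D P t (\<lambda>d. map_option (eval E) (G k d))" for k
          unfolding t_def using G \<Gamma>sU by (intro dep_texpr[OF lang]) auto
        show "dep D P (\<Gamma>s x) (\<lambda>d. map_option (\<lambda>s. s x) (G k d))" for k
          by (rule env_depD[OF G])
        show "{} \<in> \<Gamma>s x" using \<Gamma>sU by (simp add: mem_U1)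
        fix d y assume "?f d = Some y"
        then obtain s u where s: "F d = Some s" and u: "big_step eval test (While E C) s u"
          and y: "y = u x" by (auto simp: sem_comp_eq_Some)
        obtain n r where r: "r 0 = s" "r n = u" "\<not> test (eval E u)"
          "\<forall>k<n. test (eval E (r k)) \<and> big_step eval test C (r k) (r (Suc k))"
          using big_step_While_trace[OF u] by blast
        have "G k d = Some (r k)" if "k \<le> n" for k
          using that
        proof (induction k)
          case 0 show ?case by (simp add: G_def s r(1))
        next
          case (Suc k)
          then have "G k d = Some (r k)" "big_step eval test C (r k) (r (Suc k))"
            using r(4) by auto
          then have "(sem eval test C \<circ>\<^sub>m G k) d = Some (r (Suc k))"
            unfolding sem_comp_eq_Some by blast
          then show ?case by (simp add: G_def)
        qed
        then show "\<exists>n r. (\<forall>k\<le>n. G k d = Some (r k)) \<and>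
            (\<forall>k<n. test (eval E (r k))) \<and> \<not> test (eval E (r n)) \<and> y = r n x"
          using r y by (intro exI[of _ n] exI[of _ r]) simp
      qed
      then show ?thesis using True unfolding alg_setobj_While Let_def \<Gamma>s_def t_def by simp
    next
      case False
      have "dep D P (\<Gamma>s x) ?f"
        by (rule dep_restrict[OF dep_mono[OF env_depD[OF While.prems(3)] sub(1)]])
          (use False in \<open>auto simp: sem_comp_eq_Some dest: big_step_unassigned\<close>)
      then show ?thesis using False unfolding alg_setobj_While Let_def \<Gamma>s_def by simp
    qed
  qed
qed

section \<open>Tensors of information and the read-out\<close>

text \<open>Inner closures are absorbed by \<open>tc_joins_tc\<close>, leaving a single closure of
  the intersections over all choices \<open>P\<close>; the counterpart of
  \<open>mem_setobj_finprod\<close>.\<close>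

lemma QoI_finprod:
  assumes "finite X" "\<And>v. v \<in> X \<Longrightarrow> \<sigma> v \<in> carrier (QoI D)"
  shows "finprod (QoI D) \<sigma> X = tc D {meet_rel D P X | P. \<forall>v\<in>X. P v \<in> \<sigma> v}"
  using assms
proof (induction X rule: finite_induct)
  case empty
  interpret comm_quantale "QoI D" by (rule comm_quantale_QoI)
  have "tc D {D \<times> D} = {D \<times> D}" using one_closed by (simp add: QoI_simps)
  then show ?case by (simp add: QoI_simps meet_rel_def)
next
  case (insert a X)
  interpret comm_quantale "QoI D" by (rule comm_quantale_QoI)
  define MX where "MX = {meet_rel D P X | P. \<forall>v\<in>X. P v \<in> \<sigma> v}"
  have a: "\<sigma> a \<subseteq> LoI D" "tc D (\<sigma> a) = \<sigma> a" using insert.prems[of a] by (auto simp: QoI_simps)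
  have "\<sigma> v \<subseteq> LoI D" if "v \<in> X" for v using insert.prems[of v] that by (auto simp: QoI_simps)
  then have MXL: "MX \<subseteq> LoI D" unfolding MX_def using meet_rel_LoI[of X _ D] by blast
  have fin: "finprod (QoI D) \<sigma> X = tc D MX" unfolding MX_def using insert by blast
  have "finprod (QoI D) \<sigma> (insert a X) = \<sigma> a \<otimes>\<^bsub>QoI D\<^esub> finprod (QoI D) \<sigma> X"
    using insert by (intro finprod_insert) auto
  also have "\<dots> = tc D (joins (\<sigma> a) MX)"
    unfolding QoI_joins fin using tc_joins_tc[OF a(1) MXL] unfolding a(2) .
  also have "joins (\<sigma> a) MX = {meet_rel D P (insert a X) | P. \<forall>v\<in>insert a X. P v \<in> \<sigma> v}"
  proof
    show "joins (\<sigma> a) MX \<subseteq> {meet_rel D P (insert a X) | P. \<forall>v\<in>insert a X. P v \<in> \<sigma> v}"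
    proof
      fix R assume "R \<in> joins (\<sigma> a) MX"
      then obtain Q P where R: "R = Q \<inter> meet_rel D P X" and Q: "Q \<in> \<sigma> a"
        and P: "\<forall>v\<in>X. P v \<in> \<sigma> v"
        unfolding MX_def by (auto elim!: joinsE)
      have "(\<Inter>v\<in>X. (P(a := Q)) v) = (\<Inter>v\<in>X. P v)" using insert.hyps(2) by auto
      then have "R = meet_rel D (P(a := Q)) (insert a X)" unfolding R meet_rel_def by auto
      moreover have "\<forall>v\<in>insert a X. (P(a := Q)) v \<in> \<sigma> v" using P Q by simp
      ultimately show "R \<in> {meet_rel D P (insert a X) | P. \<forall>v\<in>insert a X. P v \<in> \<sigma> v}" by blast
    qed
    show "{meet_rel D P (insert a X) | P. \<forall>v\<in>insert a X. P v \<in> \<sigma> v} \<subseteq> joins (\<sigma> a) MX"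
    proof clarify
      fix P assume P: "\<forall>v\<in>insert a X. P v \<in> \<sigma> v"
      have "meet_rel D P (insert a X) = P a \<inter> meet_rel D P X" unfolding meet_rel_def by auto
      moreover have "meet_rel D P X \<in> MX" unfolding MX_def using P by blast
      ultimately show "meet_rel D P (insert a X) \<in> joins (\<sigma> a) MX" using P by (simp add: joinsI)
    qed
  qed
  finally show ?case .
qed

section \<open>Closure properties of \<open>QoI\<close> and of the read-out
  \<open>alpha\<close>\<close>

lemma determines_mono: "\<lbrakk>determines h PP; PP \<subseteq> QQ\<rbrakk> \<Longrightarrow> determines h QQ"
  unfolding determines_def by blast

text \<open>Every member of \<open>PP\<close> lies in \<open>mix D PP\<close>, and \<open>tc\<close>
  passes to coarser relations, the lower ones in the information order.\<close>

lemma QoI_down_closed: "\<lbrakk>PP \<in> carrier (QoI D); P \<in> PP; P \<subseteq> Q; Q \<in> LoI D\<rbrakk> \<Longrightarrow> Q \<in> PP"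
proof -
  assume PP: "PP \<in> carrier (QoI D)" and P: "P \<in> PP" "P \<subseteq> Q" "Q \<in> LoI D"
  have "P \<in> mix D PP" using PP P(1) by (auto simp: QoI_simps mix_def)
  then have "Q \<in> tc D PP" using P unfolding tc_def by blast
  then show ?thesis using PP by (simp add: QoI_simps)
qed

lemma QoI_finprod_closed:
  "(\<And>v. \<sigma> v \<in> carrier (QoI D)) \<Longrightarrow> finprod (QoI D) \<sigma> X \<in> carrier (QoI D)"
proof -
  interpret comm_quantale "QoI D" by (rule comm_quantale_QoI)
  show "(\<And>v. \<sigma> v \<in> carrier (QoI D)) \<Longrightarrow> finprod (QoI D) \<sigma> X \<in> carrier (QoI D)"
    by (intro finprod_closed) blast
qed

lemma alpha_closed:
  assumes "\<And>v. \<sigma> v \<in> carrier (QoI D)" shows "alpha D \<sigma> XX \<in> carrier (QoI D)"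
proof -
  interpret comm_quantale "QoI D" by (rule comm_quantale_QoI)
  show ?thesis unfolding alpha_def
    by (intro qSup_closed image_subsetI QoI_finprod_closed assms)
qed

text \<open>Both sides are joins of the same tensors, grouped differently; nested closures
  \<open>tc\<close> collapse.\<close>

lemma join_preserving_alpha:
  fixes \<sigma> :: "'v \<Rightarrow> ('d \<times> 'd) set set"
  assumes \<sigma>: "\<And>v. \<sigma> v \<in> carrier (QoI D)"
  shows "join_preserving setobj (QoI D) (alpha D \<sigma>)"
  unfolding join_preserving_def
proof (intro allI impI)
  fix S :: "'v set set set"
  let ?T = "\<lambda>X. finprod (QoI D) \<sigma> X"
  have T: "?T X \<subseteq> LoI D" for X using QoI_finprod_closed[of \<sigma> D X] \<sigma> by (simp add: QoI_simps)
  then have L: "(\<Union>X\<in>XX. ?T X) \<subseteq> LoI D" for XX by blast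
  have "tc D (\<Union>X\<in>\<Union>S. ?T X) = tc D (\<Union>XX\<in>S. tc D (\<Union>X\<in>XX. ?T X))"
  proof
    show "tc D (\<Union>X\<in>\<Union>S. ?T X) \<subseteq> tc D (\<Union>XX\<in>S. tc D (\<Union>X\<in>XX. ?T X))"
      using tc_extensive[OF L] by (intro tc_mono) blast
    have "tc D (\<Union>X\<in>XX. ?T X) \<subseteq> tc D (\<Union>X\<in>\<Union>S. ?T X)" if "XX \<in> S" for XX
      using that by (intro tc_mono) blast
    then show "tc D (\<Union>XX\<in>S. tc D (\<Union>X\<in>XX. ?T X)) \<subseteq> tc D (\<Union>X\<in>\<Union>S. ?T X)"
      by (intro tc_least L) blast
  qed
  then show "alpha D \<sigma> (qSup setobj S) = qSup (QoI D) (alpha D \<sigma> ` S)"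
    unfolding alpha_def QoI_simps setobj_simps by simp
qed

text \<open>Legality supplies one \<open>P v\<close> per variable. For this fixed \<open>P\<close>
  the invariant holds initially with the generators, \<open>env_dep_alg\<close> carries it through
  the command, and \<open>dep_determines\<close> turns it into a witness.\<close>

lemma sound_readout_alpha:
  fixes fv :: "'e \<Rightarrow> 'v::finite set" and eval :: "'e \<Rightarrow> ('v \<Rightarrow> 'val) \<Rightarrow> 'val" and D :: "'d set"
  assumes lang: "expression_language fv eval tuple"
    and \<sigma>: "\<And>v. \<sigma> v \<in> carrier (QoI D)"
  shows "sound_readout fv eval test D \<sigma> (alpha D \<sigma>)"
  unfolding sound_readout_def
proof (intro allI impI, elim conjE)
  fix C W and g :: "'v \<Rightarrow> 'd \<rightharpoonup> 'val"
  assume med: "mediator D g" and leg: "legal \<sigma> g"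
  have "\<forall>v. \<exists>Q. Q \<in> \<sigma> v \<and> (\<forall>d d'. (d, d') \<in> Q \<longrightarrow> d \<in> dom (g v) \<longrightarrow> d' \<in> dom (g v) \<longrightarrow> g v d = g v d')"
    using leg unfolding legal_def determines_def by blast
  then obtain P where P: "\<And>v. P v \<in> \<sigma> v"
    and Pg: "\<And>v d d'. \<lbrakk>(d, d') \<in> P v; d \<in> dom (g v); d' \<in> dom (g v)\<rbrakk> \<Longrightarrow> g v d = g v d'"
    by metis
  have PL: "P v \<in> LoI D" for v using P[of v] \<sigma>[of v] by (auto simp: QoI_simps)
  have "env_dep D P gen (store_of g)"
    unfolding env_dep_def
  proof
    fix v
    show "dep D P (gen v) (\<lambda>d. map_option (\<lambda>s. s v) (store_of g d))"
    proof (rule dep_restrict)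
      show "dep D P (gen v) (g v)" by (rule dep_gen, rule PL, rule Pg)
      show "g v d = Some y" if "map_option (\<lambda>s. s v) (store_of g d) = Some y" for d y
        using that domIff[of d "g v"] by (auto simp: store_of_def split: if_splits)
    qed
  qed
  then have E: "env_dep D P (Delta fv C) (sem eval test C \<circ>\<^sub>m store_of g)"
    unfolding Delta_def by (intro env_dep_alg[OF lang] U1_one U1_gen)
  have DU: "Delta fv C v \<in> U1" for v
    unfolding Delta_def by (intro alg_setobj U1_one U1_gen)
  have "dep D P (JJ fv C W)
      (\<lambda>d. map_option (\<lambda>s. restrict s W) ((sem eval test C \<circ>\<^sub>m store_of g) d))"
    unfolding JJ_def
  proof (rule dep_finprod[where \<Gamma> = "Delta fv C" and q = "\<lambda>s. restrict s W", OF finite])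
    show "Delta fv C v \<in> carrier setobj" for v by (rule U1_carrier, rule DU)
    show "dep D P (Delta fv C v) (\<lambda>d. map_option (\<lambda>s. s v) ((sem eval test C \<circ>\<^sub>m store_of g) d))" for v
      by (rule env_depD, rule E)
    fix s s' :: "'v \<Rightarrow> 'val" assume "\<And>v. v \<in> W \<Longrightarrow> s v = s' v"
    then show "restrict s W = restrict s' W" by (rule restrict_ext)
  qed
  then have "determines (map_option (\<lambda>s. restrict s W) \<circ> (sem eval test C \<circ>\<^sub>m store_of g))
      (tc D (meet_rel D P ` JJ fv C W))"
    unfolding comp_def by (rule dep_determines[OF PL])
  then show "determines (map_option (\<lambda>s. restrict s W) \<circ> (sem eval test C \<circ>\<^sub>m store_of g))
      (alpha D \<sigma> (JJ fv C W))"
  proof (rule determines_mono)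
    \<comment> \<open>The fixed \<open>P\<close> is one of the choices that generate the tensor, so
      the read-out dominates the closure obtained for \<open>P\<close>.\<close>
    have "meet_rel D P X \<in> finprod (QoI D) \<sigma> X" for X
    proof -
      have "{meet_rel D P X | P. \<forall>v\<in>X. P v \<in> \<sigma> v} \<subseteq> LoI D"
        using \<sigma> by (auto simp: QoI_simps intro!: meet_rel_LoI)
      then show ?thesis
        unfolding QoI_finprod[OF finite \<sigma>] using tc_extensive P by blast
    qed
    then show "tc D (meet_rel D P ` JJ fv C W) \<subseteq> alpha D \<sigma> (JJ fv C W)"
      unfolding alpha_def QoI_simps by (intro tc_mono) blast
  qed
qed

section \<open>Minimality\<close>

text \<open>The tensor is generated by the relations \<open>meet_rel D P X\<close>, so it is enough
  to force each of them into \<open>\<beta> (down {X})\<close> by a mediator built for that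
  \<open>P\<close>.\<close>

lemma readout_lower_bound:
  fixes fv :: "'e \<Rightarrow> 'v::finite set" and eval :: "'e \<Rightarrow> ('v \<Rightarrow> 'val) \<Rightarrow> 'val"
  assumes enc: "\<forall>P \<in> LoI D. \<exists>enc :: 'd set \<Rightarrow> 'val. inj_on enc (D // P)"
    and \<sigma>: "\<And>v. \<sigma> v \<in> above_unit (QoI D)"
    and \<beta>: "\<beta> \<in> carrier setobj \<rightarrow> carrier (QoI D)"
    and sound: "sound_readout fv eval test D \<sigma> \<beta>"
  shows "finprod (QoI D) \<sigma> X \<subseteq> \<beta> (down {X})"
proof -
  have \<sigma>c: "\<sigma> v \<in> carrier (QoI D)" and all: "D \<times> D \<in> \<sigma> v" for v
    using \<sigma>[of v] by (auto simp: above_unit_def QoI_simps)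
  have \<beta>c: "\<beta> (down {X}) \<in> carrier (QoI D)"
    using \<beta> by (auto simp: setobj_simps down_idem)
  have "meet_rel D P X \<in> \<beta> (down {X})" if P: "\<forall>v\<in>X. P v \<in> \<sigma> v" for P
  proof -
    have PL: "P v \<in> LoI D" if "v \<in> X" for v using P \<sigma>c[of v] that by (auto simp: QoI_simps)
    have "\<forall>v. \<exists>e :: 'd set \<Rightarrow> 'val. v \<in> X \<longrightarrow> inj_on e (D // P v)" using enc PL by blast
    then obtain e :: "'v \<Rightarrow> 'd set \<Rightarrow> 'val" where e: "\<And>v. v \<in> X \<Longrightarrow> inj_on (e v) (D // P v)"
      by metis
    \<comment> \<open>Variables outside \<open>X\<close> get a constant, which is legal because
      \<open>\<sigma> v\<close> lies above the unit and so contains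
      \<open>D \<times> D\<close>.\<close>
    define val where "val v d = (if v \<in> X then e v (P v `` {d}) else undefined)" for v d
    \<comment> \<open>Being defined on all of \<open>D\<close> makes \<open>h\<close> defined there
      too, so the witness \<open>Q\<close> constrains all its pairs.\<close>
    define g where "g v d = (if d \<in> D then Some (val v d) else None)" for v d
    have dom: "dom (g v) = D" for v by (auto simp: g_def split: if_splits)
    have same: "P v `` {d} = P v `` {d'} \<longleftrightarrow> (d, d') \<in> P v"
      if "v \<in> X" "d \<in> D" "d' \<in> D" for v d d'
      using eq_equiv_class_iff[of D "P v" d d'] PL that by (auto simp: LoI_def)
    have "determines (g v) (\<sigma> v)" for v
    proof (cases "v \<in> X")
      case True
      have "g v d = g v d'" if "(d, d') \<in> P v" "d \<in> D" "d' \<in> D" for d d'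
        using same[OF True that(2,3)] that by (simp add: g_def val_def)
      then show ?thesis unfolding determines_def dom using P True by blast
    next
      case False
      then show ?thesis unfolding determines_def dom using all[of v]
        by (intro bexI[of _ "D \<times> D"]) (auto simp: g_def val_def)
    qed
    then have "legal \<sigma> g" by (simp add: legal_def)
    moreover have "mediator D g" using dom unfolding mediator_def by blast
    ultimately have "determines (map_option (\<lambda>s. restrict s X) \<circ> (sem eval test Skip \<circ>\<^sub>m store_of g))
        (\<beta> (JJ fv Skip X))"
      using sound unfolding sound_readout_def by blast
    moreover have "JJ fv Skip X = down {X}"
      by (simp add: JJ_def Delta_def setobj_finprod_gen)
    moreover define h where "h = map_option (\<lambda>s. restrict s X) \<circ> store_of g"
    ultimately have "determines h (\<beta> (down {X}))" by (simp add: sem_Skip)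
    then obtain Q where Q: "Q \<in> \<beta> (down {X})"
      and Qh: "\<And>d d'. \<lbrakk>(d, d') \<in> Q; d \<in> dom h; d' \<in> dom h\<rbrakk> \<Longrightarrow> h d = h d'"
      unfolding determines_def by blast
    have h: "h d = Some (restrict (\<lambda>v. val v d) X)" if "d \<in> D" for d
      using that by (simp add: h_def store_of_def dom g_def)
    have QL: "Q \<in> LoI D" using Q \<beta>c by (auto simp: QoI_simps)
    \<comment> \<open>Equal observations give equal codes for each \<open>v\<close> in
      \<open>X\<close>, and injectivity returns equal cells of \<open>P v\<close>; thus
      \<open>Q\<close> is at least as fine as the target, and coarsening stays in the
      downset.\<close>
    have "Q \<subseteq> meet_rel D P X"
    proof clarify
      fix d d' assume dd: "(d, d') \<in> Q"
      then have d: "d \<in> D" "d' \<in> D" using LoI_D(1)[OF QL] by blast+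
      have "restrict (\<lambda>v. val v d) X = restrict (\<lambda>v. val v d') X"
        using Qh[OF dd] h[OF d(1)] h[OF d(2)] by auto
      then have "val v d = val v d'" if "v \<in> X" for v
        using that by (metis restrict_apply')
      then have "(d, d') \<in> P v" if "v \<in> X" for v
        using that same[OF that d] e[OF that] d
        by (auto simp: val_def inj_on_def quotientI)
      then show "(d, d') \<in> meet_rel D P X" using d by (simp add: meet_rel_def)
    qed
    then show ?thesis
      by (rule QoI_down_closed[OF \<beta>c Q _ meet_rel_LoI[OF PL]])
  qed
  then have "{meet_rel D P X | P. \<forall>v\<in>X. P v \<in> \<sigma> v} \<subseteq> \<beta> (down {X})" by blast
  from tc_mono[OF this, of D] show ?thesis
    using \<beta>c unfolding QoI_finprod[OF finite \<sigma>c] by (simp add: QoI_simps)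
qed

text \<open>For comparable elements the join of the pair is the larger one, and preservation makes
  its image an upper bound of both images.\<close>

lemma join_preserving_mono:
  assumes "join_preserving setobj (QoI D) \<beta>" "\<beta> \<in> carrier setobj \<rightarrow> carrier (QoI D)"
    and "XX \<in> carrier setobj" "YY \<in> carrier setobj" "XX \<subseteq> YY"
  shows "\<beta> XX \<subseteq> \<beta> YY"
proof -
  interpret comm_quantale "QoI D" by (rule comm_quantale_QoI)
  have "\<beta> (\<Union>{XX, YY}) = qSup (QoI D) (\<beta> ` {XX, YY})"
    using assms unfolding join_preserving_def setobj_simps(4)[symmetric] by blast
  moreover have "\<Union>{XX, YY} = YY" using assms(5) by blast
  ultimately have "\<beta> YY = qSup (QoI D) (\<beta> ` {XX, YY})" by simp
  moreover have "qle (QoI D) (\<beta> XX) (qSup (QoI D) (\<beta> ` {XX, YY}))"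
    using assms by (intro qSup_upper) auto
  ultimately show ?thesis by (simp add: QoI_simps)
qed

theorem theorem10:
  fixes D :: "'d set"
    and fv :: "'e \<Rightarrow> 'v::finite set"
    and eval :: "'e \<Rightarrow> ('v \<Rightarrow> 'val) \<Rightarrow> 'val"
    and tuple :: "'v list \<Rightarrow> 'e"
    and test :: "'val \<Rightarrow> bool"
    and \<sigma> :: "'v \<Rightarrow> ('d \<times> 'd) set set"
  assumes "finite D"
    and "expression_language fv eval tuple"
    and "\<exists>pair :: 'val \<times> 'val \<Rightarrow> 'val. inj pair"
    and "\<forall>P \<in> LoI D. \<exists>enc :: 'd set \<Rightarrow> 'val. inj_on enc (D // P)"
    and "\<sigma> \<in> UNIV \<rightarrow> above_unit (QoI D)"
  shows "(\<forall>\<beta>. \<beta> \<in> carrier setobj \<rightarrow> carrier (QoI D) \<and>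
              join_preserving setobj (QoI D) \<beta> \<and>
              sound_readout fv eval test D \<sigma> \<beta> \<longrightarrow>
            (\<forall>XX \<in> carrier setobj. qle (QoI D) (alpha D \<sigma> XX) (\<beta> XX))) \<and>
         (alpha D \<sigma> \<in> carrier setobj \<rightarrow> carrier (QoI D) \<and>
          join_preserving setobj (QoI D) (alpha D \<sigma>) \<and>
          sound_readout fv eval test D \<sigma> (alpha D \<sigma>))"
proof (intro conjI allI impI ballI; (elim conjE)?)
  have \<sigma>: "\<sigma> v \<in> above_unit (QoI D)" "\<sigma> v \<in> carrier (QoI D)" for v
    using assms(5) by (auto simp: above_unit_def)
  show "alpha D \<sigma> \<in> carrier setobj \<rightarrow> carrier (QoI D)" by (intro funcsetI alpha_closed \<sigma>)
  show "join_preserving setobj (QoI D) (alpha D \<sigma>)" by (intro join_preserving_alpha \<sigma>)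
  show "sound_readout fv eval test D \<sigma> (alpha D \<sigma>)"
    by (intro sound_readout_alpha[OF assms(2)] \<sigma>)
  fix \<beta> and XX :: "'v set set"
  assume \<beta>: "\<beta> \<in> carrier setobj \<rightarrow> carrier (QoI D)" and join: "join_preserving setobj (QoI D) \<beta>"
    and sound: "sound_readout fv eval test D \<sigma> \<beta>" and XX: "XX \<in> carrier setobj"
  have "finprod (QoI D) \<sigma> X \<subseteq> \<beta> XX" if "X \<in> XX" for X
  proof -
    have "finprod (QoI D) \<sigma> X \<subseteq> \<beta> (down {X})"
      by (rule readout_lower_bound[OF assms(4) _ \<beta> sound]) (rule \<sigma>)
    \<comment> \<open>A downset containing \<open>X\<close> contains \<open>down {X}\<close>, so
      monotonicity applies.\<close>
    also have "\<dots> \<subseteq> \<beta> XX"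
      using that carrier_downD[OF XX]
      by (intro join_preserving_mono[OF join \<beta> _ XX]) (auto simp: setobj_simps down_idem down_def)
    finally show ?thesis .
  qed
  \<comment> \<open>Being closed under \<open>tc\<close>, \<open>\<beta> XX\<close> absorbs the join
    that defines \<open>alpha\<close>.\<close>
  then have "tc D (\<Union>X\<in>XX. finprod (QoI D) \<sigma> X) \<subseteq> tc D (\<beta> XX)" by (intro tc_mono) blast
  moreover have "tc D (\<beta> XX) = \<beta> XX" using \<beta> XX by (auto simp: QoI_simps)
  ultimately show "qle (QoI D) (alpha D \<sigma> XX) (\<beta> XX)" by (simp add: alpha_def QoI_simps)
qed

end
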